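(* Extended Frege$+\forall$-Red (\textsf{eFrege}$+\forall$-Red) simulates Merge Resolution (\textsf{M-Res}): there is a polynomial $P$ such that for every closed prenex QBF $\Pi\phi$ with CNF matrix $\phi$ and every \textsf{M-Res} refutation $\pi$ of $\Pi\phi$, there is an \textsf{eFrege}$+\forall$-Red refutation of $\Pi\phi$ of size at most $P(|\pi|)$.
   Context: A closed PCNF QBF is $\Pi\phi$ where $\Pi$ is a linear quantifier prefix over all variables of $\phi$ and $\phi$ is a CNF. Universal variables form the set $U$, existential ones $E$; "$y<u$" means $y$ precedes $u$ in $\Pi$. A proof system $p$ simulates $q$ if there is a fixed polynomial $P$ such that every $q$-refutation $\pi$ of a formula can be turned into a $p$-refutation of that formula of size at most $P(|\pi|)$. \textsf{eFrege}$+\forall$-Red: lines are propositional formulas; it has the rules of a Frege system (a fixed finite sound and implicationally complete set of axiom and rule schemata for propositional logic), the extension rule (introduce the axiom $v\leftrightarrow f$ for a fresh variable $v$ not occurring in $f$ or earlier lines; $v$ is added to the prefix as an existential variable immediately right of the variables of $f$), and the reduction rule: from a formula $F$ containing universal variable $u$ such that no variable of $F$ is right of $u$ in the prefix, derive $F[u/0]$ or $F[u/1]$. A refutation of $\Pi\phi$ derives $\bot$ from the clauses of $\phi$. \textsf{M-Res}: for $u\in U$ let $E_u$ be the existential variables left of $u$. A merge map $M^u_i$ for line $i$ is either trivial, or a set of nodes in $\{1,\dots,i\}$ with a construction function assigning each node $j$ either a constant in $\{0,1\}$ (leaf) or a triple $(x,b,c)$ with $x\in E_u$ and $b,c<j$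 nodes; the root $r(u,i)$ is the largest node. It represents the function $h^u_{i,j}$ on assignments to $E_u$: for a leaf $t$, $h^u_{i,t}$ is its constant; for $M^u_i(a)=(x,b,c)$, $h^u_{i,a}=(x\wedge h^u_{i,b})\vee(\neg x\wedge h^u_{i,c})$. Maps $M^u_j,M^u_k$ are consistent if they agree on every common node; isomorphic if there is a bijection $f$ of nodes with $M^u_j(a)=(x,b,c)\Rightarrow M^u_k(f(a))=(x,f(b),f(c))$ and leaves mapped to leaves with equal constants. $\mathrm{Select}(M^u_j,M^u_k)$ returns $M^u_j$ if $M^u_k$ is trivial or they are isomorphic, returns $M^u_k$ if $M^u_j$ is trivial and not isomorphic to $M^u_k$, and fails otherwise. $\mathrm{Merge}(x,M^u_j,M^u_k)$ (for consistent maps) returns $M^u_i$ containing all nodes of both with their values plus a new root $i$ with $M^u_i(i)=(x,r(u,j),r(u,k))$. Lines are pairs $(C_i,\{M^u_i: u\in U\})$ with $C_i$ a clause of existential literals. Axiom: for a clause $C$ of $\phi$, $C_i$ is the set of existential literals of $C$; $M^u_i$ is trivial if neither $u$ nor $\neg u$ is in $C$, is the single leaf $i$ with value $0$ if $u\in C$, and the single leaf $i$ with value $1$ if $\neg u\in C$. Resolution: from lines $j,k$ with $\neg x\in C_j$, $x\in C_k$, derive $C_i=(C_j\cup C_k)\setminus\{x,\neg x\}$ with each $M^u_i$ either $\mathrm{Select}(M^u_j,M^u_k)$ (when defined) or $\mathrm{Merge}(x,M^u_j,M^u_k)$ when $x<u$ and the maps are consistent. A refutation is a proof ending in a line with the empty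 clause.
   Formalization: Clauses in M-Res lines are required to contain no complementary literals; otherwise the rule is unsound: for the true formula ∃x∃y (¬x∨y)(x∨¬y)(y) one derives {y,¬y} and then, with {y}, the empty clause. *)

theory Defs
  imports "HOL-Computational_Algebra.Polynomial"
begin

section \<open>Closed PCNF formulas\<close>

type_synonym var = nat

datatype quant = Forall | Exists

type_synonym prefix = "(quant \<times> var) list"

datatype literal = Pos var | Neg var

primrec lvar :: "literal \<Rightarrow> var" where
  "lvar (Pos x) = x"
| "lvar (Neg x) = x"

type_synonym cnf = "literal list list"

definition prefix_vars :: "prefix \<Rightarrow> var set" where
  "prefix_vars Q = snd ` set Q"

definition universals :: "prefix \<Rightarrow> var set" where
  "universals Q = {u. (Forall, u) \<in> set Q}"

definition existentials :: "prefix \<Rightarrow> var set" where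
  "existentials Q = {x. (Exists, x) \<in> set Q}"

definition precedes :: "prefix \<Rightarrow> var \<Rightarrow> var \<Rightarrow> bool" where
  "precedes Q y z \<longleftrightarrow> (\<exists>i j. i < j \<and> j < length Q \<and> snd (Q ! i) = y \<and> snd (Q ! j) = z)"

text \<open>
  The lists standing for clauses are repetition-free: the clauses are sets of literals, and the
  list only fixes the order in which the literals are written when the clause is read as a formula.
\<close>

definition closed_pcnf :: "prefix \<Rightarrow> cnf \<Rightarrow> bool" where
  "closed_pcnf Q \<phi> \<longleftrightarrow>
     distinct (map snd Q) \<and> (\<forall>C\<in>set \<phi>. distinct C \<and> lvar ` set C \<subseteq> prefix_vars Q)"


section \<open>Propositional formulas and Frege systems\<close>

datatype form =
    Fls | Tru | Var var | Neg_f form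
  | And_f form form | Or_f form form | Imp_f form form | Iff_f form form

primrec fvars :: "form \<Rightarrow> var set" where
  "fvars Fls = {}"
| "fvars Tru = {}"
| "fvars (Var x) = {x}"
| "fvars (Neg_f A) = fvars A"
| "fvars (And_f A B) = fvars A \<union> fvars B"
| "fvars (Or_f A B) = fvars A \<union> fvars B"
| "fvars (Imp_f A B) = fvars A \<union> fvars B"
| "fvars (Iff_f A B) = fvars A \<union> fvars B"

primrec feval :: "(var \<Rightarrow> bool) \<Rightarrow> form \<Rightarrow> bool" where
  "feval \<alpha> Fls = False"
| "feval \<alpha> Tru = True"
| "feval \<alpha> (Var x) = \<alpha> x"
| "feval \<alpha> (Neg_f A) = (\<not> feval \<alpha> A)"
| "feval \<alpha> (And_f A B) = (feval \<alpha> A \<and> feval \<alpha> B)"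
| "feval \<alpha> (Or_f A B) = (feval \<alpha> A \<or> feval \<alpha> B)"
| "feval \<alpha> (Imp_f A B) = (feval \<alpha> A \<longrightarrow> feval \<alpha> B)"
| "feval \<alpha> (Iff_f A B) = (feval \<alpha> A \<longleftrightarrow> feval \<alpha> B)"

primrec fsubst :: "(var \<Rightarrow> form) \<Rightarrow> form \<Rightarrow> form" where
  "fsubst \<sigma> Fls = Fls"
| "fsubst \<sigma> Tru = Tru"
| "fsubst \<sigma> (Var x) = \<sigma> x"
| "fsubst \<sigma> (Neg_f A) = Neg_f (fsubst \<sigma> A)"
| "fsubst \<sigma> (And_f A B) = And_f (fsubst \<sigma> A) (fsubst \<sigma> B)"
| "fsubst \<sigma> (Or_f A B) = Or_f (fsubst \<sigma> A) (fsubst \<sigma> B)"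
| "fsubst \<sigma> (Imp_f A B) = Imp_f (fsubst \<sigma> A) (fsubst \<sigma> B)"
| "fsubst \<sigma> (Iff_f A B) = Iff_f (fsubst \<sigma> A) (fsubst \<sigma> B)"

text \<open>Number of symbols; a variable counts as one symbol.\<close>

primrec fsize :: "form \<Rightarrow> nat" where
  "fsize Fls = 1"
| "fsize Tru = 1"
| "fsize (Var x) = 1"
| "fsize (Neg_f A) = fsize A + 1"
| "fsize (And_f A B) = fsize A + fsize B + 1"
| "fsize (Or_f A B) = fsize A + fsize B + 1"
| "fsize (Imp_f A B) = fsize A + fsize B + 1"
| "fsize (Iff_f A B) = fsize A + fsize B + 1"

primrec lit_form :: "literal \<Rightarrow> form" where
  "lit_form (Pos x) = Var x"
| "lit_form (Neg x) = Neg_f (Var x)"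

definition clause_form :: "literal list \<Rightarrow> form" where
  "clause_form C = foldr (\<lambda>l A. Or_f (lit_form l) A) C Fls"

definition entails :: "form set \<Rightarrow> form \<Rightarrow> bool" where
  "entails \<Gamma> A \<longleftrightarrow> (\<forall>\<alpha>. (\<forall>B\<in>\<Gamma>. feval \<alpha> B) \<longrightarrow> feval \<alpha> A)"

text \<open>
  A rule schema consists of premises and a conclusion, whose variables act as metavariables for
  formulas; an axiom schema is a rule schema without premises.
\<close>

type_synonym rule_schema = "form list \<times> form"

inductive frege_derivable :: "rule_schema set \<Rightarrow> form set \<Rightarrow> form \<Rightarrow> bool" for F \<Gamma> where
  hyp: "A \<in> \<Gamma> \<Longrightarrow> frege_derivable F \<Gamma> A"
| rule: "(Ps, A) \<in> F \<Longrightarrow> (\<And>B. B \<in> set Ps \<Longrightarrow> frege_derivable F \<Gamma> (fsubst \<sigma> B)) \<Longrightarrow>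
         frege_derivable F \<Gamma> (fsubst \<sigma> A)"

definition frege_system :: "rule_schema set \<Rightarrow> bool" where
  "frege_system F \<longleftrightarrow>
     finite F \<and>
     (\<forall>(Ps, A)\<in>F. entails (set Ps) A) \<and>
     (\<forall>\<Gamma> A. finite \<Gamma> \<longrightarrow> entails \<Gamma> A \<longrightarrow> frege_derivable F \<Gamma> A)"


section \<open>eFrege with universal reduction\<close>

text \<open>
  The new existential variable is placed directly behind the shortest initial segment of the
  prefix that contains all variables of the formula (leftmost if the formula has no variables).
\<close>

definition insert_ext :: "var \<Rightarrow> form \<Rightarrow> prefix \<Rightarrow> prefix" where
  "insert_ext v A Q =
     (let k = (LEAST k. fvars A \<subseteq> prefix_vars (take k Q)) in take k Q @ (Exists, v) # drop k Q)"

text \<open>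
  \<open>efrege F Q \<phi> Q' ls\<close>: the list \<open>ls\<close> of lines is a derivation from the clauses of \<open>\<phi>\<close>, and \<open>Q'\<close>
  is the prefix \<open>Q\<close> with the extension variables introduced so far. All lines are formulas over the
  variables of the current prefix.
\<close>

inductive efrege ::
  "rule_schema set \<Rightarrow> prefix \<Rightarrow> cnf \<Rightarrow> prefix \<Rightarrow> form list \<Rightarrow> bool" for F Q \<phi> where
  start: "efrege F Q \<phi> Q []"
| clause: "efrege F Q \<phi> Q' ls \<Longrightarrow> C \<in> set \<phi> \<Longrightarrow>
    efrege F Q \<phi> Q' (ls @ [clause_form C])"
| frege: "efrege F Q \<phi> Q' ls \<Longrightarrow> (Ps, A) \<in> F \<Longrightarrow> \<forall>B\<in>set Ps. fsubst \<sigma> B \<in> set ls \<Longrightarrow>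
    fvars (fsubst \<sigma> A) \<subseteq> prefix_vars Q' \<Longrightarrow>
    efrege F Q \<phi> Q' (ls @ [fsubst \<sigma> A])"
| extension: "efrege F Q \<phi> Q' ls \<Longrightarrow> fvars A \<subseteq> prefix_vars Q' \<Longrightarrow>
    v \<notin> fvars A \<Longrightarrow> \<forall>B\<in>set ls. v \<notin> fvars B \<Longrightarrow> v \<notin> prefix_vars Q' \<Longrightarrow>
    efrege F Q \<phi> (insert_ext v A Q') (ls @ [Iff_f (Var v) A])"
| reduction: "efrege F Q \<phi> Q' ls \<Longrightarrow> A \<in> set ls \<Longrightarrow> u \<in> universals Q' \<Longrightarrow> u \<in> fvars A \<Longrightarrow>
    \<forall>y\<in>fvars A. \<not> precedes Q' u y \<Longrightarrow> c \<in> {Fls, Tru} \<Longrightarrow>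
    efrege F Q \<phi> Q' (ls @ [fsubst (Var(u := c)) A])"

definition efrege_refutation :: "rule_schema set \<Rightarrow> prefix \<Rightarrow> cnf \<Rightarrow> form list \<Rightarrow> bool" where
  "efrege_refutation F Q \<phi> ls \<longleftrightarrow> (\<exists>Q'. efrege F Q \<phi> Q' ls) \<and> ls \<noteq> [] \<and> last ls = Fls"

definition efrege_size :: "form list \<Rightarrow> nat" where
  "efrege_size ls = sum_list (map fsize ls)"


section \<open>Merge Resolution\<close>

text \<open>
  A merge map is the partial function from its nodes to their values; the trivial merge map is the
  empty one. Lines are numbered from 0, so the nodes of a merge map in line \<open>i\<close> lie in
  \<open>{0..i}\<close>.
\<close>

datatype node_val = Leaf bool | Node var nat nat

type_synonym merge_map = "nat \<rightharpoonup> node_val"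

abbreviation trivial :: "merge_map \<Rightarrow> bool" where
  "trivial M \<equiv> M = Map.empty"

definition wf_merge_map :: "prefix \<Rightarrow> nat \<Rightarrow> var \<Rightarrow> merge_map \<Rightarrow> bool" where
  "wf_merge_map Q i u M \<longleftrightarrow>
     dom M \<subseteq> {0..i} \<and>
     (\<forall>a x b c. M a = Some (Node x b c) \<longrightarrow>
        x \<in> existentials Q \<and> precedes Q x u \<and> b \<in> dom M \<and> c \<in> dom M \<and> b < a \<and> c < a)"

definition root :: "merge_map \<Rightarrow> nat" where
  "root M = Max (dom M)"

definition consistent :: "merge_map \<Rightarrow> merge_map \<Rightarrow> bool" where
  "consistent M N \<longleftrightarrow> (\<forall>a \<in> dom M \<inter> dom N. M a = N a)"

definition isomorphic :: "merge_map \<Rightarrow> merge_map \<Rightarrow> bool" where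
  "isomorphic M N \<longleftrightarrow> (\<exists>f. bij_betw f (dom M) (dom N) \<and>
     (\<forall>a x b c. M a = Some (Node x b c) \<longrightarrow> N (f a) = Some (Node x (f b) (f c))) \<and>
     (\<forall>a t. M a = Some (Leaf t) \<longrightarrow> N (f a) = Some (Leaf t)))"

definition select :: "merge_map \<Rightarrow> merge_map \<Rightarrow> merge_map option" where
  "select M N =
     (if trivial N \<or> isomorphic M N then Some M
      else if trivial M then Some N
      else None)"

definition merge :: "nat \<Rightarrow> var \<Rightarrow> merge_map \<Rightarrow> merge_map \<Rightarrow> merge_map" where
  "merge i x M N = (M ++ N)(i \<mapsto> Node x (root M) (root N))"

type_synonym mres_line = "literal set \<times> (var \<Rightarrow> merge_map)"

text \<open>
  A clause contains no complementary literals. Without this convention the resolution rule, which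
  deletes both literals of the pivot from both premises, is unsound.
\<close>

definition mres_wf_line :: "prefix \<Rightarrow> nat \<Rightarrow> mres_line \<Rightarrow> bool" where
  "mres_wf_line Q i L \<longleftrightarrow>
     finite (fst L) \<and> lvar ` fst L \<subseteq> existentials Q \<and>
     (\<nexists>x. Pos x \<in> fst L \<and> Neg x \<in> fst L) \<and>
     (\<forall>u\<in>universals Q. wf_merge_map Q i u (snd L u))"

definition mres_axiom :: "prefix \<Rightarrow> cnf \<Rightarrow> nat \<Rightarrow> mres_line \<Rightarrow> bool" where
  "mres_axiom Q \<phi> i L \<longleftrightarrow> (\<exists>C\<in>set \<phi>.
     fst L = {l \<in> set C. lvar l \<in> existentials Q} \<and>
     (\<forall>u\<in>universals Q.
        (Pos u \<notin> set C \<and> Neg u \<notin> set C \<longrightarrow> trivial (snd L u)) \<and>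
        (Pos u \<in> set C \<longrightarrow> snd L u = [i \<mapsto> Leaf False]) \<and>
        (Neg u \<in> set C \<longrightarrow> snd L u = [i \<mapsto> Leaf True])))"

text \<open>
  \<open>Lj\<close> and \<open>Lk\<close> are the premises containing the negative and the positive pivot literal.
  Merging needs both roots, hence is confined to nontrivial maps.
\<close>

definition mres_resolution ::
  "prefix \<Rightarrow> nat \<Rightarrow> var \<Rightarrow> mres_line \<Rightarrow> mres_line \<Rightarrow> mres_line \<Rightarrow> bool" where
  "mres_resolution Q i x Lj Lk L \<longleftrightarrow>
     Neg x \<in> fst Lj \<and> Pos x \<in> fst Lk \<and>
     fst L = (fst Lj \<union> fst Lk) - {Pos x, Neg x} \<and>
     (\<forall>u\<in>universals Q.
        select (snd Lj u) (snd Lk u) = Some (snd L u) \<or>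
        precedes Q x u \<and> \<not> trivial (snd Lj u) \<and> \<not> trivial (snd Lk u) \<and>
        consistent (snd Lj u) (snd Lk u) \<and>
        snd L u = merge i x (snd Lj u) (snd Lk u))"

definition mres_refutation :: "prefix \<Rightarrow> cnf \<Rightarrow> mres_line list \<Rightarrow> bool" where
  "mres_refutation Q \<phi> \<pi> \<longleftrightarrow>
     (\<forall>i<length \<pi>. mres_wf_line Q i (\<pi> ! i) \<and>
        (mres_axiom Q \<phi> i (\<pi> ! i) \<or>
         (\<exists>j<i. \<exists>k<i. \<exists>x. mres_resolution Q i x (\<pi> ! j) (\<pi> ! k) (\<pi> ! i)))) \<and>
     \<pi> \<noteq> [] \<and> fst (last \<pi>) = {}"

text \<open>
  The size counts the lines together with the literals and the merge map nodes they contain.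
\<close>

definition mres_size :: "prefix \<Rightarrow> mres_line list \<Rightarrow> nat" where
  "mres_size Q \<pi> =
     (\<Sum>L\<leftarrow>\<pi>. 1 + card (fst L) + (\<Sum>u\<in>universals Q. card (dom (snd L u))))"

end

(* The lines of an M-Res proof are simulated under extension variables s u a, one for each node a of a
   merge map of the universal u, defined by the leaf constant or by "if x then s u b else s u c". As u
   is right of all variables queried by its merge maps, s u a is placed left of u. A line with clause C
   and merge maps with roots r u becomes the disjunction of C and of all u <> s u (r u), i.e. "if the
   universal player follows the strategies, then C". Resolution steps preserve this by a case
   distinction on the pivot; for Select on isomorphic maps the extension variables of corresponding
   nodes are first proved equivalent, bottom up. The line of the empty clause contains only disjuncts
   u <> s u (r u). They are removed from the rightmost u to the leftmost: reducing u to both constants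
   leaves s u (r u) and its negation.

   All propositional steps are instances of finitely many sound schemata. Each of them has some
   derivation in the given Frege system, and substitution into it costs only a constant factor. *)

theory Submission
  imports Defs "HOL-Library.Nat_Bijection"
begin

text \<open>A node carries the number of the line that creates it, and later lines never change its
  value. Hence all lines share one extension variable per universal and node, and keeping a map
  under Select, or two maps under Merge, calls for no new definitions of old nodes.

  The delicate case is Select on isomorphic maps. An isomorphism is defined by node values alone,
  whereas the root is the largest node, so it is not clear that roots correspond. They do for maps
  that arise in a proof, because there every node other than the root has a parent.

  All extension variables are introduced before any other line. The prefix is then fixed for the
  rest of the derivation, and step bounds for this one prefix can simply be added.

  The size of an M-Res proof does not count the matrix, so the length of a clause used as an axiom
  has to be recovered from the literals and merge maps of its line.\<close>

lemma fsubst_fsubst: "fsubst \<tau> (fsubst \<sigma> A) = fsubst (\<lambda>x. fsubst \<tau> (\<sigma> x)) A"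
  by (induction A) auto

lemma fsize_pos: "1 \<le> fsize A"
  by (induction A) auto

lemma fvars_fsubst: "fvars (fsubst \<sigma> A) = (\<Union>x\<in>fvars A. fvars (\<sigma> x))"
  by (induction A) auto

lemma fsize_fsubst_le:
  assumes "\<And>x. fsize (\<sigma> x) \<le> N"
  shows "fsize (fsubst \<sigma> A) \<le> fsize A * N"
proof -
  have "1 \<le> N" using assms[of undefined] fsize_pos[of "\<sigma> undefined"] by simp
  then show ?thesis
  proof (induction A)
    case (Var x)
    then show ?case using assms by simp
  qed (simp_all add: algebra_simps)
qed

lemma fsubst_constant_for_var:
  assumes "c \<in> {Fls, Tru}"
  shows "fsize (fsubst (Var(u := c)) A) = fsize A"
  using assms by (induction A) auto

lemma fsubst_fresh: "u \<notin> fvars A \<Longrightarrow> fsubst (Var(u := B)) A = A"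
  by (induction A) auto


section \<open>Derivations of bounded length and line size\<close>

text \<open>Quantifying over all derivations \<open>ls\<close> with prefix \<open>Q'\<close> makes
  these statements composable: the added lines can continue any derivation that contains \<Gamma>,
  and they leave the prefix as it is.\<close>

definition derives ::
  "rule_schema set \<Rightarrow> prefix \<Rightarrow> cnf \<Rightarrow> prefix \<Rightarrow> nat \<Rightarrow> nat \<Rightarrow> form set \<Rightarrow> form set \<Rightarrow> bool" where
  "derives F Q \<phi> Q' N n \<Gamma> T \<longleftrightarrow>
     (\<forall>ls. efrege F Q \<phi> Q' ls \<longrightarrow> \<Gamma> \<subseteq> set ls \<longrightarrow>
        (\<exists>ls'. efrege F Q \<phi> Q' (ls @ ls') \<and> length ls' \<le> n \<and> (\<forall>A\<in>set ls'. fsize A \<le> N) \<and>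
               T \<subseteq> set (ls @ ls')))"

lemma derives_refl: "T \<subseteq> \<Gamma> \<Longrightarrow> derives F Q \<phi> Q' N n \<Gamma> T"
  unfolding derives_def by (metis append_Nil2 empty_iff list.set(1) list.size(3) order_trans zero_le)

lemma derives_mono:
  assumes "derives F Q \<phi> Q' N n \<Gamma> T" "N \<le> N'" "n \<le> n'" "\<Gamma> \<subseteq> \<Gamma>'" "T' \<subseteq> T"
  shows "derives F Q \<phi> Q' N' n' \<Gamma>' T'"
  using assms unfolding derives_def by (meson order_trans)

lemma derives_cut:
  assumes "derives F Q \<phi> Q' N n \<Gamma> T" "derives F Q \<phi> Q' N m (\<Gamma> \<union> T) S"
  shows "derives F Q \<phi> Q' N (n + m) \<Gamma> (T \<union> S)"
  unfolding derives_def
proof (intro allI impI)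
  fix ls assume ls: "efrege F Q \<phi> Q' ls" "\<Gamma> \<subseteq> set ls"
  obtain l1 where l1: "efrege F Q \<phi> Q' (ls @ l1)" "length l1 \<le> n" "\<forall>A\<in>set l1. fsize A \<le> N"
    "T \<subseteq> set (ls @ l1)"
    using assms(1) ls unfolding derives_def by meson
  have "\<Gamma> \<union> T \<subseteq> set (ls @ l1)" using ls(2) l1(4) by auto
  then obtain l2 where l2: "efrege F Q \<phi> Q' ((ls @ l1) @ l2)" "length l2 \<le> m"
    "\<forall>A\<in>set l2. fsize A \<le> N" "S \<subseteq> set ((ls @ l1) @ l2)"
    using assms(2) l1(1) unfolding derives_def by meson
  show "\<exists>ls'. efrege F Q \<phi> Q' (ls @ ls') \<and> length ls' \<le> n + m \<and> (\<forall>A\<in>set ls'. fsize A \<le> N) \<and>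
      T \<union> S \<subseteq> set (ls @ ls')"
    using l1 l2 by (intro exI[of _ "l1 @ l2"]) auto
qed

lemma derives_UN:
  assumes "finite I" "\<And>i. i \<in> I \<Longrightarrow> derives F Q \<phi> Q' N n \<Gamma> (T i)"
  shows "derives F Q \<phi> Q' N (card I * n) \<Gamma> (\<Union>i\<in>I. T i)"
  using assms
proof (induction I)
  case empty
  then show ?case by (simp add: derives_refl)
next
  case (insert i I)
  have "derives F Q \<phi> Q' N (n + card I * n) \<Gamma> (T i \<union> (\<Union>i\<in>I. T i))"
    using insert by (intro derives_cut) (auto intro: derives_mono)
  with insert show ?case by simp
qed

lemma derives_line:
  assumes "\<And>ls. efrege F Q \<phi> Q' ls \<Longrightarrow> \<Gamma> \<subseteq> set ls \<Longrightarrow> efrege F Q \<phi> Q' (ls @ [A])" "fsize A \<le> N"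
  shows "derives F Q \<phi> Q' N 1 \<Gamma> {A}"
  unfolding derives_def
proof (intro allI impI)
  fix ls assume "efrege F Q \<phi> Q' ls" "\<Gamma> \<subseteq> set ls"
  then show "\<exists>ls'. efrege F Q \<phi> Q' (ls @ ls') \<and> length ls' \<le> 1 \<and> (\<forall>A\<in>set ls'. fsize A \<le> N) \<and>
      {A} \<subseteq> set (ls @ ls')"
    using assms by (intro exI[of _ "[A]"]) auto
qed

lemma derives_frege:
  assumes "(Ps, A) \<in> F" "\<And>B. B \<in> set Ps \<Longrightarrow> fsubst \<sigma> B \<in> \<Gamma>"
    "fvars (fsubst \<sigma> A) \<subseteq> prefix_vars Q'" "fsize (fsubst \<sigma> A) \<le> N"
  shows "derives F Q \<phi> Q' N 1 \<Gamma> {fsubst \<sigma> A}"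
  using assms by (intro derives_line) (auto intro!: efrege.frege)

section \<open>Frege derivations under substitution\<close>

definition bounded_form :: "prefix \<Rightarrow> nat \<Rightarrow> form \<Rightarrow> bool" where
  "bounded_form Q N A \<longleftrightarrow> fvars A \<subseteq> prefix_vars Q \<and> fsize A \<le> N"

text \<open>Applying \<tau> to one fixed derivation of \<open>A\<close> gives a derivation again, in
  which a line of size k has grown to at most k * N. The constant therefore depends on that
  derivation only and is uniform in \<tau>, the matrix and the prefix. All values of \<tau> are
  bounded, since the derivation may use variables that occur neither in \<Gamma> nor in
  \<open>A\<close>.\<close>

lemma frege_derivable_derives:
  assumes "frege_derivable F \<Gamma> A"
  shows "\<exists>c. \<forall>Q \<phi> Q' N \<tau>. (\<forall>x. bounded_form Q' N (\<tau> x)) \<longrightarrow>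
           derives F Q \<phi> Q' (c * N) c (fsubst \<tau> ` \<Gamma>) {fsubst \<tau> A}"
  using assms
proof induction
  case (hyp A)
  then show ?case by (intro exI[of _ 0]) (auto intro!: derives_refl)
next
  case (rule Ps A \<sigma>)
  have "\<exists>c. \<forall>Q \<phi> Q' N \<tau>. (\<forall>x. bounded_form Q' N (\<tau> x)) \<longrightarrow>
      derives F Q \<phi> Q' (c * N) c (fsubst \<tau> ` \<Gamma>) ((\<lambda>B. fsubst \<tau> (fsubst \<sigma> B)) ` set Ps)"
    using rule(3)
  proof (induction Ps)
    case Nil
    then show ?case by (intro exI[of _ 0]) (auto intro!: derives_refl)
  next
    case (Cons B Ps)
    obtain c1 where c1: "\<And>Q \<phi> Q' N \<tau>. \<forall>x. bounded_form Q' N (\<tau> x) \<Longrightarrow>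
      derives F Q \<phi> Q' (c1 * N) c1 (fsubst \<tau> ` \<Gamma>) ((\<lambda>B. fsubst \<tau> (fsubst \<sigma> B)) ` set Ps)"
      using Cons by (meson list.set_intros(2))
    obtain c2 where c2: "\<And>Q \<phi> Q' N \<tau>. \<forall>x. bounded_form Q' N (\<tau> x) \<Longrightarrow>
      derives F Q \<phi> Q' (c2 * N) c2 (fsubst \<tau> ` \<Gamma>) {fsubst \<tau> (fsubst \<sigma> B)}"
      using Cons.prems[of B] by auto
    show ?case
    proof (intro exI[of _ "c1 + c2"] allI impI)
      fix Q \<phi> Q' N and \<tau> :: "var \<Rightarrow> form"
      assume b: "\<forall>x. bounded_form Q' N (\<tau> x)"
      have "derives F Q \<phi> Q' ((c1 + c2) * N) (c1 + c2) (fsubst \<tau> ` \<Gamma>)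
        (((\<lambda>B. fsubst \<tau> (fsubst \<sigma> B)) ` set Ps) \<union> {fsubst \<tau> (fsubst \<sigma> B)})"
        by (rule derives_cut[OF derives_mono[OF c1[OF b]] derives_mono[OF c2[OF b]]]) auto
      then show "derives F Q \<phi> Q' ((c1 + c2) * N) (c1 + c2) (fsubst \<tau> ` \<Gamma>)
        ((\<lambda>B. fsubst \<tau> (fsubst \<sigma> B)) ` set (B # Ps))"
        by (simp add: Un_commute)
    qed
  qed
  then obtain c where c: "\<And>Q \<phi> Q' N \<tau>. \<forall>x. bounded_form Q' N (\<tau> x) \<Longrightarrow>
      derives F Q \<phi> Q' (c * N) c (fsubst \<tau> ` \<Gamma>) ((\<lambda>B. fsubst \<tau> (fsubst \<sigma> B)) ` set Ps)"
    by blast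
  \<comment> \<open>A formula has size at least 1, so this summand pays for the size of the
    conclusion and also for the one additional line.\<close>
  let ?d = "c + fsize (fsubst \<sigma> A)"
  show ?case
  proof (intro exI[of _ "?d"] allI impI)
    fix Q \<phi> Q' N and \<tau> :: "var \<Rightarrow> form"
    assume b: "\<forall>x. bounded_form Q' N (\<tau> x)"
    have "fsize (fsubst \<tau> (fsubst \<sigma> A)) \<le> fsize (fsubst \<sigma> A) * N"
      using b by (intro fsize_fsubst_le) (auto simp: bounded_form_def)
    then have size: "fsize (fsubst \<tau> (fsubst \<sigma> A)) \<le> ?d * N"
      by (simp add: algebra_simps)
    have vars: "fvars (fsubst \<tau> (fsubst \<sigma> A)) \<subseteq> prefix_vars Q'"
      using b by (auto simp: bounded_form_def fvars_fsubst[of \<tau>])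
    have "derives F Q \<phi> Q' (?d * N) 1
        (fsubst \<tau> ` \<Gamma> \<union> (\<lambda>B. fsubst \<tau> (fsubst \<sigma> B)) ` set Ps) {fsubst \<tau> (fsubst \<sigma> A)}"
      using size vars rule(1) unfolding fsubst_fsubst by (intro derives_frege[of Ps]) auto
    from derives_cut[OF derives_mono[OF c[OF b]] this]
    have "derives F Q \<phi> Q' (?d * N) (c + 1) (fsubst \<tau> ` \<Gamma>)
        ((\<lambda>B. fsubst \<tau> (fsubst \<sigma> B)) ` set Ps \<union> {fsubst \<tau> (fsubst \<sigma> A)})"
      by (simp add: algebra_simps)
    then show "derives F Q \<phi> Q' (?d * N) ?d (fsubst \<tau> ` \<Gamma>) {fsubst \<tau> (fsubst \<sigma> A)}"
      using fsize_pos[of "fsubst \<sigma> A"] by (elim derives_mono) auto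
  qed
qed

text \<open>Implicational completeness gives a derivation of each sound schema, and the constants of
  finitely many schemata can be added up. With 1 \<le> c, a single line of size at most N later fits
  into one unit of cost.\<close>

lemma frege_schemata_derives:
  assumes "frege_system F" "finite R" "\<forall>(Ps, A)\<in>R. entails (set Ps) A"
  shows "\<exists>c\<ge>1. \<forall>(Ps, A)\<in>R. \<forall>Q \<phi> Q' N \<tau>. (\<forall>x. bounded_form Q' N (\<tau> x)) \<longrightarrow>
           derives F Q \<phi> Q' (c * N) c (fsubst \<tau> ` set Ps) {fsubst \<tau> A}"
  using assms(2,3)
proof (induction R)
  case empty
  then show ?case by auto
next
  case (insert r R)
  obtain Ps A where r: "r = (Ps, A)" by fastforce
  obtain c1 where c1: "c1 \<ge> 1" "\<forall>(Ps, A)\<in>R. \<forall>Q \<phi> Q' N \<tau>. (\<forall>x. bounded_form Q' N (\<tau> x)) \<longrightarrow>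
           derives F Q \<phi> Q' (c1 * N) c1 (fsubst \<tau> ` set Ps) {fsubst \<tau> A}"
    using insert by auto
  have "frege_derivable F (set Ps) A"
    using assms(1) insert.prems r unfolding frege_system_def by auto
  from frege_derivable_derives[OF this] obtain c2 where c2:
    "\<forall>Q \<phi> Q' N \<tau>. (\<forall>x. bounded_form Q' N (\<tau> x)) \<longrightarrow>
           derives F Q \<phi> Q' (c2 * N) c2 (fsubst \<tau> ` set Ps) {fsubst \<tau> A}" by blast
  have mono: "derives F Q \<phi> Q' ((c1 + c2) * N) (c1 + c2) \<Gamma> T"
    if "derives F Q \<phi> Q' (c * N) c \<Gamma> T" "c \<in> {c1, c2}" for Q \<phi> Q' N c \<Gamma> T
    using that by (elim derives_mono) auto
  have "derives F Q \<phi> Q' ((c1 + c2) * N) (c1 + c2) (fsubst \<tau> ` set Ps') {fsubst \<tau> A'}"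
    if "(Ps', A') \<in> insert r R" "\<forall>x. bounded_form Q' N (\<tau> x)" for Ps' A' Q \<phi> Q' N \<tau>
  proof (cases "(Ps', A') = r")
    case True
    then show ?thesis using c2 that(2) r by (intro mono[of _ _ _ c2]) auto
  next
    case False
    then show ?thesis using c1(2) that by (intro mono[of _ _ _ c1]) auto
  qed
  then show ?case using c1(1) by (intro exI[of _ "c1 + c2"]) auto
qed


section \<open>The inference rules of the simulation\<close>

abbreviation mismatch :: "form \<Rightarrow> form \<Rightarrow> form" where
  "mismatch A B \<equiv> Neg_f (Iff_f A B)"

abbreviation ite :: "form \<Rightarrow> form \<Rightarrow> form \<Rightarrow> form" where
  "ite X A B \<equiv> Or_f (And_f X A) (And_f (Neg_f X) B)"

text \<open>In this order: disjunctions and modus ponens, case distinction on a pivot, exchange of a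
  strategy value for an equivalent one (Select), unfolding of an inner node (Merge), unfolding of a
  leaf (axioms), evaluation of the two reductions of a universal, equivalence of isomorphic nodes.
  The schemata have fixed arity; longer disjunctions are handled by iterating the first
  ones.\<close>

definition sim_rules :: "rule_schema list" where
  "sim_rules =
    [([], Imp_f (Var 0) (Or_f (Var 0) (Var 1))),
     ([Imp_f (Var 0) (Var 2)], Imp_f (Var 0) (Or_f (Var 1) (Var 2))),
     ([], Imp_f Fls (Var 0)),
     ([Imp_f (Var 0) (Var 2), Imp_f (Var 1) (Var 2)], Imp_f (Or_f (Var 0) (Var 1)) (Var 2)),
     ([Var 0, Imp_f (Var 0) (Var 1)], Var 1),
     ([Imp_f (Var 0) (Var 2)], Imp_f (Var 0) (Imp_f (Var 1) (Var 2))),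
     ([], Imp_f (Neg_f (Var 0)) (Imp_f (Var 0) (Var 1))),
     ([], Imp_f (Var 0) (Imp_f (Neg_f (Var 0)) (Var 1))),
     ([Imp_f (Var 0) (Var 1), Imp_f (Neg_f (Var 0)) (Var 1)], Var 1),
     ([Iff_f (Var 1) (Var 2), Imp_f (mismatch (Var 0) (Var 1)) (Var 3)],
      Imp_f (mismatch (Var 0) (Var 2)) (Var 3)),
     ([Iff_f (Var 1) (ite (Var 4) (Var 2) (Var 3)), Imp_f (mismatch (Var 0) (Var 1)) (Var 5)],
      Imp_f (mismatch (Var 0) (Var 2)) (Imp_f (Var 4) (Var 5))),
     ([Iff_f (Var 1) (ite (Var 4) (Var 2) (Var 3)), Imp_f (mismatch (Var 0) (Var 1)) (Var 5)],
      Imp_f (mismatch (Var 0) (Var 3)) (Imp_f (Neg_f (Var 4)) (Var 5))),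
     ([Iff_f (Var 1) Fls, Imp_f (mismatch (Var 0) (Var 1)) (Var 2)], Imp_f (Var 0) (Var 2)),
     ([Iff_f (Var 1) Tru, Imp_f (mismatch (Var 0) (Var 1)) (Var 2)], Imp_f (Neg_f (Var 0)) (Var 2)),
     ([Or_f (mismatch Fls (Var 0)) (Var 1), Or_f (mismatch Tru (Var 0)) (Var 1)], Var 1),
     ([Iff_f (Var 0) (Var 2), Iff_f (Var 1) (Var 2)], Iff_f (Var 0) (Var 1)),
     ([Iff_f (Var 0) (ite (Var 2) (Var 3) (Var 4)), Iff_f (Var 1) (ite (Var 2) (Var 5) (Var 6)),
       Iff_f (Var 3) (Var 5), Iff_f (Var 4) (Var 6)],
      Iff_f (Var 0) (Var 1))]"

lemma sim_rules_sound: "\<forall>(Ps, A)\<in>set sim_rules. entails (set Ps) A"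
  by (auto simp: sim_rules_def entails_def)

definition dis :: "form list \<Rightarrow> form" where
  "dis L = foldr Or_f L Fls"

lemma dis_simps [simp]: "dis [] = Fls" "dis (A # L) = Or_f A (dis L)"
  by (simp_all add: dis_def)

lemma clause_form_dis: "clause_form C = dis (map lit_form C)"
  by (simp add: clause_form_def dis_def foldr_map comp_def)

lemma fvars_dis: "fvars (dis L) = (\<Union>A\<in>set L. fvars A)"
  by (induction L) auto

lemma fsize_dis_le: "(\<And>A. A \<in> set L \<Longrightarrow> fsize A \<le> k) \<Longrightarrow> fsize (dis L) \<le> length L * (k + 1) + 1"
proof (induction L)
  case (Cons A L)
  then have "fsize A \<le> k" "fsize (dis L) \<le> length L * (k + 1) + 1" by auto
  then show ?case by simp
qed simp

primrec node_form :: "(nat \<Rightarrow> var) \<Rightarrow> node_val \<Rightarrow> form" where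
  "node_form t (Leaf b) = (if b then Tru else Fls)"
| "node_form t (Node x b c) = ite (Var x) (Var (t b)) (Var (t c))"

locale frege_simulation =
  fixes F :: "rule_schema set" and Q :: prefix and \<phi> :: cnf and Q' :: prefix and c N :: nat
  assumes c_ge_1: "1 \<le> c" and N_ge_1: "1 \<le> N"
    and schema: "(Ps, A) \<in> set sim_rules \<Longrightarrow> \<forall>x. bounded_form Q' N (\<tau> x) \<Longrightarrow>
      derives F Q \<phi> Q' (c * N) c (fsubst \<tau> ` set Ps) {fsubst \<tau> A}"
begin

abbreviation ok :: "form \<Rightarrow> bool" where
  "ok \<equiv> bounded_form Q' N"

text \<open>
  Lines and their sizes are counted in units of \<open>c\<close>, the constant that bounds the derivations of the
  schemata in \<open>F\<close>; so \<open>F\<close> does not enter the counts below.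
\<close>

definition dv :: "nat \<Rightarrow> form set \<Rightarrow> form set \<Rightarrow> bool" where
  "dv n = derives F Q \<phi> Q' (c * N) (c * n)"

lemma dv_mono: "dv n \<Gamma> T \<Longrightarrow> n \<le> n' \<Longrightarrow> \<Gamma> \<subseteq> \<Gamma>' \<Longrightarrow> T' \<subseteq> T \<Longrightarrow> dv n' \<Gamma>' T'"
  unfolding dv_def by (erule derives_mono) auto

lemma dv_refl: "T \<subseteq> \<Gamma> \<Longrightarrow> dv n \<Gamma> T"
  unfolding dv_def by (rule derives_refl)

lemma dv_Un:
  assumes "dv n \<Gamma> T" "dv m (\<Gamma> \<union> T) S" "n + m \<le> k"
  shows "dv k \<Gamma> (T \<union> S)"
  using derives_cut[OF assms(1,2)[unfolded dv_def]] mult_le_mono2[OF assms(3), of c]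
  unfolding dv_def by (auto elim!: derives_mono simp: distrib_left)

lemma dv_cut: "dv n \<Gamma> T \<Longrightarrow> dv m (\<Gamma> \<union> T) S \<Longrightarrow> n + m \<le> k \<Longrightarrow> dv k \<Gamma> S"
  by (rule dv_mono[OF dv_Un]) auto

lemma dv_UN:
  assumes "finite I" "\<And>i. i \<in> I \<Longrightarrow> dv n \<Gamma> (T i)" "card I * n \<le> m"
  shows "dv m \<Gamma> (\<Union>i\<in>I. T i)"
proof -
  have "derives F Q \<phi> Q' (c * N) (card I * (c * n)) \<Gamma> (\<Union>i\<in>I. T i)"
    by (rule derives_UN) (use assms in \<open>auto simp: dv_def\<close>)
  then show ?thesis unfolding dv_def
    using mult_le_mono2[OF assms(3), of c] by (elim derives_mono) (auto simp: algebra_simps)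
qed

lemma dv_image:
  assumes "finite I" "\<And>i. i \<in> I \<Longrightarrow> dv n \<Gamma> {f i}" "card I * n \<le> m"
  shows "dv m \<Gamma> (f ` I)"
  using dv_UN[of I n \<Gamma> "\<lambda>i. {f i}" m] assms by (simp add: UNION_singleton_eq_range)

section \<open>Admissible formulas and instances of the schemata\<close>

lemma ok_simps [simp]:
  "ok Fls" "ok Tru" "ok (Var x) \<longleftrightarrow> x \<in> prefix_vars Q'"
  using N_ge_1 by (auto simp: bounded_form_def)

lemma ok_OrD: "ok (Or_f A B) \<Longrightarrow> ok A" "ok (Or_f A B) \<Longrightarrow> ok B"
  by (auto simp: bounded_form_def)

lemma ok_dis_member: "ok (dis L) \<Longrightarrow> A \<in> set L \<Longrightarrow> ok A"
  by (induction L) (auto dest: ok_OrD)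

text \<open>The default matters: a Frege derivation of a schema may mention variables outside the
  schema, and their images must be bounded formulas over the prefix as well.\<close>

definition inst :: "form list \<Rightarrow> var \<Rightarrow> form" where
  "inst fs i = (if i < length fs then fs ! i else Tru)"

lemma dv_rule:
  assumes "k < length sim_rules" "\<forall>A\<in>set As. ok A"
    "\<forall>B\<in>set (fst (sim_rules ! k)). fsubst (inst As) B \<in> \<Gamma>"
  shows "dv 1 \<Gamma> {fsubst (inst As) (snd (sim_rules ! k))}"
proof -
  have "derives F Q \<phi> Q' (c * N) c (fsubst (inst As) ` set (fst (sim_rules ! k)))
      {fsubst (inst As) (snd (sim_rules ! k))}"
    using assms by (intro schema) (auto simp: inst_def)
  then show ?thesis using assms(3) unfolding dv_def by (elim derives_mono) auto
qed

lemma dv_or_left: "ok A \<Longrightarrow> ok B \<Longrightarrow> dv 1 \<Gamma> {Imp_f A (Or_f A B)}"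
  using dv_rule[of 0 "[A, B]" \<Gamma>] by (simp add: inst_def sim_rules_def)

lemma dv_or_right:
  "ok A \<Longrightarrow> ok B \<Longrightarrow> ok C \<Longrightarrow> Imp_f A C \<in> \<Gamma> \<Longrightarrow> dv 1 \<Gamma> {Imp_f A (Or_f B C)}"
  using dv_rule[of 1 "[A, B, C]" \<Gamma>] by (simp add: inst_def sim_rules_def)

lemma dv_ex_falso: "ok A \<Longrightarrow> dv 1 \<Gamma> {Imp_f Fls A}"
  using dv_rule[of 2 "[A]" \<Gamma>] by (simp add: inst_def sim_rules_def)

lemma dv_or_elim:
  "ok A \<Longrightarrow> ok B \<Longrightarrow> ok C \<Longrightarrow> Imp_f A C \<in> \<Gamma> \<Longrightarrow> Imp_f B C \<in> \<Gamma> \<Longrightarrow> dv 1 \<Gamma> {Imp_f (Or_f A B) C}"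
  using dv_rule[of 3 "[A, B, C]" \<Gamma>] by (simp add: inst_def sim_rules_def)

lemma dv_mp: "ok A \<Longrightarrow> ok B \<Longrightarrow> A \<in> \<Gamma> \<Longrightarrow> Imp_f A B \<in> \<Gamma> \<Longrightarrow> dv 1 \<Gamma> {B}"
  using dv_rule[of 4 "[A, B]" \<Gamma>] by (simp add: inst_def sim_rules_def)

lemma dv_imp_weaken:
  "ok A \<Longrightarrow> ok B \<Longrightarrow> ok C \<Longrightarrow> Imp_f A C \<in> \<Gamma> \<Longrightarrow> dv 1 \<Gamma> {Imp_f A (Imp_f B C)}"
  using dv_rule[of 5 "[A, B, C]" \<Gamma>] by (simp add: inst_def sim_rules_def)

lemma dv_contradiction:
  "ok A \<Longrightarrow> ok B \<Longrightarrow> dv 1 \<Gamma> {Imp_f (Neg_f A) (Imp_f A B)}"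
  "ok A \<Longrightarrow> ok B \<Longrightarrow> dv 1 \<Gamma> {Imp_f A (Imp_f (Neg_f A) B)}"
  using dv_rule[of 6 "[A, B]" \<Gamma>] dv_rule[of 7 "[A, B]" \<Gamma>] by (simp_all add: inst_def sim_rules_def)

lemma dv_cases:
  "ok A \<Longrightarrow> ok B \<Longrightarrow> Imp_f A B \<in> \<Gamma> \<Longrightarrow> Imp_f (Neg_f A) B \<in> \<Gamma> \<Longrightarrow> dv 1 \<Gamma> {B}"
  using dv_rule[of 8 "[A, B]" \<Gamma>] by (simp add: inst_def sim_rules_def)

lemma dv_mismatch_iff:
  "ok A \<Longrightarrow> ok B \<Longrightarrow> ok C \<Longrightarrow> ok D \<Longrightarrow> Iff_f B C \<in> \<Gamma> \<Longrightarrow> Imp_f (mismatch A B) D \<in> \<Gamma> \<Longrightarrow>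
   dv 1 \<Gamma> {Imp_f (mismatch A C) D}"
  using dv_rule[of 9 "[A, B, C, D]" \<Gamma>] by (simp add: inst_def sim_rules_def)

lemma dv_mismatch_ite:
  assumes "ok A" "ok B" "ok C" "ok D" "ok X" "ok G"
    "Iff_f B (ite X C D) \<in> \<Gamma>" "Imp_f (mismatch A B) G \<in> \<Gamma>"
  shows "dv 1 \<Gamma> {Imp_f (mismatch A C) (Imp_f X G)}"
    and "dv 1 \<Gamma> {Imp_f (mismatch A D) (Imp_f (Neg_f X) G)}"
  using assms dv_rule[of 10 "[A, B, C, D, X, G]" \<Gamma>] dv_rule[of 11 "[A, B, C, D, X, G]" \<Gamma>]
  by (simp_all add: inst_def sim_rules_def)

lemma dv_mismatch_const:
  "ok A \<Longrightarrow> ok B \<Longrightarrow> ok C \<Longrightarrow> Iff_f B Fls \<in> \<Gamma> \<Longrightarrow> Imp_f (mismatch A B) C \<in> \<Gamma> \<Longrightarrow> dv 1 \<Gamma> {Imp_f A C}"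
  "ok A \<Longrightarrow> ok B \<Longrightarrow> ok C \<Longrightarrow> Iff_f B Tru \<in> \<Gamma> \<Longrightarrow> Imp_f (mismatch A B) C \<in> \<Gamma> \<Longrightarrow>
    dv 1 \<Gamma> {Imp_f (Neg_f A) C}"
  using dv_rule[of 12 "[A, B, C]" \<Gamma>] dv_rule[of 13 "[A, B, C]" \<Gamma>]
  by (simp_all add: inst_def sim_rules_def)

lemma dv_drop_mismatch:
  "ok A \<Longrightarrow> ok B \<Longrightarrow> Or_f (mismatch Fls A) B \<in> \<Gamma> \<Longrightarrow> Or_f (mismatch Tru A) B \<in> \<Gamma> \<Longrightarrow> dv 1 \<Gamma> {B}"
  using dv_rule[of 14 "[A, B]" \<Gamma>] by (simp add: inst_def sim_rules_def)

lemma dv_iff_common: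
  "ok A \<Longrightarrow> ok B \<Longrightarrow> ok C \<Longrightarrow> Iff_f A C \<in> \<Gamma> \<Longrightarrow> Iff_f B C \<in> \<Gamma> \<Longrightarrow> dv 1 \<Gamma> {Iff_f A B}"
  using dv_rule[of 15 "[A, B, C]" \<Gamma>] by (simp add: inst_def sim_rules_def)

lemma dv_iff_ite:
  "ok A \<Longrightarrow> ok B \<Longrightarrow> ok X \<Longrightarrow> ok C \<Longrightarrow> ok D \<Longrightarrow> ok C' \<Longrightarrow> ok D' \<Longrightarrow>
   Iff_f A (ite X C D) \<in> \<Gamma> \<Longrightarrow> Iff_f B (ite X C' D') \<in> \<Gamma> \<Longrightarrow>
   Iff_f C C' \<in> \<Gamma> \<Longrightarrow> Iff_f D D' \<in> \<Gamma> \<Longrightarrow> dv 1 \<Gamma> {Iff_f A B}"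
  using dv_rule[of 16 "[A, B, X, C, D, C', D']" \<Gamma>] by (simp add: inst_def sim_rules_def)

section \<open>Disjunctions of unbounded length\<close>

lemma dv_dis_intro: "ok (dis L) \<Longrightarrow> A \<in> set L \<Longrightarrow> dv (length L) \<Gamma> {Imp_f A (dis L)}"
proof (induction L)
  case (Cons B L)
  have oks: "ok A" "ok B" "ok (dis L)"
    using Cons.prems by (auto dest: ok_OrD intro: ok_dis_member[of "B # L"])
  show ?case
  proof (cases "A = B")
    case True
    then show ?thesis using oks by (auto intro: dv_mono[OF dv_or_left])
  next
    case False
    then have "dv (length L) \<Gamma> {Imp_f A (dis L)}" using Cons oks by simp
    moreover have "dv 1 (\<Gamma> \<union> {Imp_f A (dis L)}) {Imp_f A (dis (B # L))}"
      using oks by (simp add: dv_or_right del: One_nat_def)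
    ultimately show ?thesis by (rule dv_cut) simp
  qed
qed simp

lemma dv_dis_elim_imp:
  "ok (dis L) \<Longrightarrow> ok G \<Longrightarrow> \<forall>A\<in>set L. Imp_f A G \<in> \<Gamma> \<Longrightarrow> dv (length L + 1) \<Gamma> {Imp_f (dis L) G}"
proof (induction L)
  case Nil
  then show ?case using dv_ex_falso[of G] by simp
next
  case (Cons B L)
  then have oks: "ok B" "ok (dis L)" by (auto dest: ok_OrD)
  then have "dv (length L + 1) \<Gamma> {Imp_f (dis L) G}" using Cons by simp
  moreover have "dv 1 (\<Gamma> \<union> {Imp_f (dis L) G}) {Imp_f (dis (B # L)) G}"
    using oks Cons.prems by (simp add: dv_or_elim del: One_nat_def)
  ultimately show ?case by (rule dv_cut) simp
qed

lemma dv_dis_elim: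
  assumes "ok (dis L)" "ok G" "\<forall>A\<in>set L. Imp_f A G \<in> \<Gamma>" "dis L \<in> \<Gamma>"
  shows "dv (length L + 2) \<Gamma> {G}"
proof -
  have "dv 1 (\<Gamma> \<union> {Imp_f (dis L) G}) {G}" using assms by (intro dv_mp[of "dis L"]) auto
  from dv_cut[OF dv_dis_elim_imp[OF assms(1-3)] this] show ?thesis by simp
qed

text \<open>The allowance of two steps per disjunct is dictated by Select on isomorphic maps: one
  step exchanges the strategy variable, the other weakens by the pivot.\<close>

lemma dv_dis_elim_steps:
  assumes "ok (dis L)" "ok G" "dis L \<in> \<Gamma>" "\<And>A. A \<in> set L \<Longrightarrow> dv 2 \<Gamma> {Imp_f A G}"
  shows "dv (3 * length L + 2) \<Gamma> {G}"
proof -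
  have "dv (2 * length L) \<Gamma> ((\<lambda>A. Imp_f A G) ` set L)"
    using assms(4) card_length[of L] by (intro dv_image[where n=2]) auto
  moreover have "dv (length L + 2) (\<Gamma> \<union> (\<lambda>A. Imp_f A G) ` set L) {G}"
    using assms by (intro dv_dis_elim) auto
  ultimately show ?thesis by (rule dv_cut) simp
qed

lemma dv_dis_intros:
  assumes "ok (dis L)" "length L * length L \<le> n"
  shows "dv n \<Gamma> ((\<lambda>A. Imp_f A (dis L)) ` set L)"
proof (rule dv_image[OF _ dv_dis_intro[OF assms(1)]])
  show "card (set L) * length L \<le> n"
    using mult_le_mono1[OF card_length[of L], of "length L"] assms(2) by linarith
qed simp_all

text \<open>Case distinction on \<open>X\<close>: \<open>Lj\<close> yields \<open>G\<close> if
  \<open>X\<close> holds, and \<open>Lk\<close> if it fails. In a resolution step on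
  \<open>X\<close> these are the premises with the negative and the positive pivot literal.\<close>

lemma dv_resolve:
  assumes "ok (dis Lj)" "ok (dis Lk)" "ok G" "ok X" "ok (Imp_f X G)" "ok (Imp_f (Neg_f X) G)"
    and "dis Lj \<in> \<Gamma>" "dis Lk \<in> \<Gamma>"
    and "\<And>A. A \<in> set Lj \<Longrightarrow> dv 2 \<Gamma> {Imp_f A (Imp_f X G)}"
    and "\<And>A. A \<in> set Lk \<Longrightarrow> dv 2 \<Gamma> {Imp_f A (Imp_f (Neg_f X) G)}"
  shows "dv (3 * length Lj + 3 * length Lk + 5) \<Gamma> {G}"
proof -
  have "dv (3 * length Lj + 2) \<Gamma> {Imp_f X G}"
    using assms by (intro dv_dis_elim_steps) auto
  moreover have "dv (3 * length Lk + 3) (\<Gamma> \<union> {Imp_f X G}) {G}"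
  proof (rule dv_cut)
    show "dv (3 * length Lk + 2) (\<Gamma> \<union> {Imp_f X G}) {Imp_f (Neg_f X) G}"
      by (rule dv_mono[OF dv_dis_elim_steps[of Lk]]) (use assms in auto)
    show "dv 1 (\<Gamma> \<union> {Imp_f X G} \<union> {Imp_f (Neg_f X) G}) {G}"
      using assms by (intro dv_cases[of X]) auto
  qed simp
  ultimately show ?thesis by (rule dv_cut) simp
qed


text \<open>Induction over node numbers with one step for each number. A leaf and its image are
  equivalent to the same constant. An inner node queries the same variable as its image, and its
  children, being smaller, have already been matched with theirs.\<close>

lemma dv_homomorphism:
  assumes M: "\<And>a v. M a = Some v \<Longrightarrow> Iff_f (Var (t a)) (node_form t v) \<in> \<Gamma>"
    and M': "\<And>a v. M' a = Some v \<Longrightarrow> Iff_f (Var (t a)) (node_form t v) \<in> \<Gamma>"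
    and vars: "\<And>a. a \<in> dom M \<union> dom M' \<Longrightarrow> t a \<in> prefix_vars Q'"
    and child: "\<And>a x b c. M a = Some (Node x b c) \<Longrightarrow>
      x \<in> prefix_vars Q' \<and> b \<in> dom M \<and> c \<in> dom M \<and> b < a \<and> c < a"
    and node: "\<And>a x b c. M a = Some (Node x b c) \<Longrightarrow> M' (f a) = Some (Node x (f b) (f c))"
    and leaf: "\<And>a b. M a = Some (Leaf b) \<Longrightarrow> M' (f a) = Some (Leaf b)"
  shows "dv m \<Gamma> {Iff_f (Var (t a)) (Var (t (f a))) |a. a \<in> dom M \<and> a < m}"
    (is "dv m \<Gamma> (?T m)")
proof (induction m)
  case 0
  then show ?case by (simp add: dv_refl)
next
  case (Suc m)
  have f_dom: "f a \<in> dom M'" if "a \<in> dom M" for a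
    using that node leaf by (cases "the (M a)") (auto simp: domIff)
  have "dv 1 (\<Gamma> \<union> ?T m) (?T (Suc m))"
  proof (cases "M m")
    case None
    then have "?T (Suc m) = ?T m" by (auto simp: less_Suc_eq)
    then show ?thesis by (simp add: dv_refl)
  next
    case (Some v)
    have m: "t m \<in> prefix_vars Q'" "t (f m) \<in> prefix_vars Q'"
      using Some f_dom[of m] vars by auto
    have "dv 1 (\<Gamma> \<union> ?T m) {Iff_f (Var (t m)) (Var (t (f m)))}"
    proof (cases v)
      case (Leaf b)
      show ?thesis
        by (rule dv_iff_common[of _ _ "if b then Tru else Fls"])
          (use m Some Leaf M M' leaf in fastforce)+
    next
      case (Node x b c)
      have bc: "b \<in> dom M" "c \<in> dom M" "b < m" "c < m" "x \<in> prefix_vars Q'"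
        using child Some Node by auto
      show ?thesis
      proof (rule dv_iff_ite[of _ _ "Var x" "Var (t b)" "Var (t c)" "Var (t (f b))" "Var (t (f c))"])
        show "Iff_f (Var (t m)) (ite (Var x) (Var (t b)) (Var (t c))) \<in> \<Gamma> \<union> ?T m"
          using M[OF Some] by (simp add: Node)
        show "Iff_f (Var (t (f m))) (ite (Var x) (Var (t (f b))) (Var (t (f c)))) \<in> \<Gamma> \<union> ?T m"
          using M'[OF node[OF Some[unfolded Node]]] by simp
      qed (use m bc vars f_dom in auto)
    qed
    moreover have "?T (Suc m) = insert (Iff_f (Var (t m)) (Var (t (f m)))) (?T m)"
      using Some by (auto simp: less_Suc_eq)
    ultimately show ?thesis
      using dv_cut[of 1 "\<Gamma> \<union> ?T m" "{Iff_f (Var (t m)) (Var (t (f m)))}" 0 "?T (Suc m)" 1]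
      by (auto intro: dv_refl)
  qed
  with Suc show ?case by (rule dv_cut) simp
qed

section \<open>Matrix clauses and universal reduction as steps\<close>

lemma ok_size: "ok A \<Longrightarrow> fsize A \<le> c * N"
  using mult_le_mono1[OF c_ge_1, of N] unfolding bounded_form_def by linarith

lemma dv_clause: "C \<in> set \<phi> \<Longrightarrow> ok (clause_form C) \<Longrightarrow> dv 1 \<Gamma> {clause_form C}"
  unfolding dv_def using c_ge_1
  by (intro derives_mono[OF derives_line[of _ _ _ _ \<Gamma> _ "c * N"]])
    (auto intro: efrege.clause ok_size)

lemma dv_reduction:
  assumes "A \<in> \<Gamma>" "u \<in> universals Q'" "u \<in> fvars A" "\<forall>y\<in>fvars A. \<not> precedes Q' u y"
    "b \<in> {Fls, Tru}" "ok A"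
  shows "dv 1 \<Gamma> {fsubst (Var(u := b)) A}"
proof -
  have "fsize (fsubst (Var(u := b)) A) \<le> c * N"
    using fsubst_constant_for_var[OF assms(5), of u A] ok_size[OF assms(6)] by simp
  then have "derives F Q \<phi> Q' (c * N) 1 \<Gamma> {fsubst (Var(u := b)) A}"
    using assms by (intro derives_line) (auto intro!: efrege.reduction)
  then show ?thesis unfolding dv_def using c_ge_1 by (elim derives_mono) auto
qed

end


section \<open>Quantifier prefixes\<close>

lemma prefix_vars_simps [simp]:
  "prefix_vars [] = {}" "prefix_vars (p # Q) = insert (snd p) (prefix_vars Q)"
  "prefix_vars (Q @ R) = prefix_vars Q \<union> prefix_vars R"
  by (auto simp: prefix_vars_def)

lemma prefix_vars_eq: "prefix_vars Q = universals Q \<union> existentials Q"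
proof (intro set_eqI iffI)
  fix x assume "x \<in> prefix_vars Q"
  then obtain q where "(q, x) \<in> set Q" by (auto simp: prefix_vars_def)
  then show "x \<in> universals Q \<union> existentials Q"
    by (cases q) (auto simp: universals_def existentials_def)
qed (force simp: prefix_vars_def universals_def existentials_def)

lemma finite_universals: "finite (universals Q)"
proof (rule finite_subset)
  show "universals Q \<subseteq> prefix_vars Q" by (simp add: prefix_vars_eq)
qed (simp add: prefix_vars_def)

text \<open>Cutting the prefix between the two variables is the form of the order that is easy to
  follow when a variable is inserted.\<close>

lemma precedes_iff_split:
  "precedes Q y z \<longleftrightarrow> (\<exists>xs ys. Q = xs @ ys \<and> y \<in> prefix_vars xs \<and> z \<in> prefix_vars ys)"
proof
  assume "precedes Q y z"
  then obtain i j where ij: "i < j" "j < length Q" "snd (Q ! i) = y" "snd (Q ! j) = z"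
    unfolding precedes_def by blast
  have "Q ! i \<in> set (take j Q)" using ij by (auto simp: in_set_conv_nth intro!: exI[of _ i])
  moreover have "Q ! j \<in> set (drop j Q)" using ij by (metis Cons_nth_drop_Suc list.set_intros(1))
  ultimately show "\<exists>xs ys. Q = xs @ ys \<and> y \<in> prefix_vars xs \<and> z \<in> prefix_vars ys"
    using ij unfolding prefix_vars_def by (metis append_take_drop_id imageI)
next
  assume "\<exists>xs ys. Q = xs @ ys \<and> y \<in> prefix_vars xs \<and> z \<in> prefix_vars ys"
  then obtain xs ys i j where "Q = xs @ ys" "i < length xs" "j < length ys"
    "y = snd (xs ! i)" "z = snd (ys ! j)"
    by (auto simp: prefix_vars_def in_set_conv_nth)
  then show "precedes Q y z"
    unfolding precedes_def
    by (intro exI[of _ i] exI[of _ "length xs + j"]) (simp add: nth_append)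
qed

lemma precedes_in_prefix: "precedes Q y z \<Longrightarrow> y \<in> prefix_vars Q \<and> z \<in> prefix_vars Q"
  by (auto simp: precedes_iff_split)

lemma precedes_index:
  assumes "distinct (map snd Q)" "j < length Q"
  shows "precedes Q y (snd (Q ! j)) \<longleftrightarrow> (\<exists>i<j. snd (Q ! i) = y)"
proof -
  have "j' = j" if "j' < length Q" "snd (Q ! j') = snd (Q ! j)" for j'
    using that assms nth_eq_iff_index_eq[OF assms(1), of j' j] by simp
  then show ?thesis using assms(2) unfolding precedes_def by blast
qed

lemma precedes_trans:
  assumes "distinct (map snd Q)" "precedes Q x y" "precedes Q y z"
  shows "precedes Q x z"
proof -
  obtain j k where jk: "j < k" "k < length Q" "y = snd (Q ! j)" "z = snd (Q ! k)"
    using assms(3) unfolding precedes_def by blast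
  then obtain i where "i < j" "snd (Q ! i) = x"
    using assms precedes_index[OF assms(1), of j] by auto
  then show ?thesis using jk unfolding precedes_def by (intro exI[of _ i] exI[of _ k]) auto
qed

lemma precedes_irrefl:
  assumes "distinct (map snd Q)"
  shows "\<not> precedes Q x x"
proof
  assume "precedes Q x x"
  then obtain i j where "i < j" "j < length Q" "snd (Q ! i) = x" "snd (Q ! j) = x"
    unfolding precedes_def by blast
  then show False using nth_eq_iff_index_eq[OF assms, of i j] by simp
qed

lemma sorted_wrt_precedes: "sorted_wrt (precedes Q) (map snd Q)"
  unfolding sorted_wrt_iff_nth_less precedes_def by fastforce

section \<open>Insertion of an extension variable into the prefix\<close>

lemma insert_ext_split:
  assumes "fvars A \<subseteq> prefix_vars Q"
  obtains xs ys where "Q = xs @ ys" "insert_ext v A Q = xs @ (Exists, v) # ys"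
    "\<And>xs' ys'. Q = xs' @ ys' \<Longrightarrow> fvars A \<subseteq> prefix_vars xs' \<Longrightarrow> length xs \<le> length xs'"
proof -
  let ?k = "LEAST k. fvars A \<subseteq> prefix_vars (take k Q)"
  have "length (take ?k Q) \<le> length xs'" if "Q = xs' @ ys'" "fvars A \<subseteq> prefix_vars xs'" for xs' ys'
    using Least_le[of "\<lambda>k. fvars A \<subseteq> prefix_vars (take k Q)" "length xs'"] that by simp
  then show ?thesis using that[of "take ?k Q" "drop ?k Q"] by (simp add: insert_ext_def Let_def)
qed

lemma insert_ext_properties:
  assumes "fvars A \<subseteq> prefix_vars Q" "v \<notin> prefix_vars Q" "distinct (map snd Q)"
  shows prefix_vars_insert_ext: "prefix_vars (insert_ext v A Q) = insert v (prefix_vars Q)"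
    and universals_insert_ext: "universals (insert_ext v A Q) = universals Q"
    and distinct_insert_ext: "distinct (map snd (insert_ext v A Q))"
    and precedes_insert_ext: "precedes Q y z \<Longrightarrow> precedes (insert_ext v A Q) y z"
    and precedes_insert_ext_new: "u \<in> prefix_vars Q \<Longrightarrow> \<forall>y\<in>fvars A. precedes Q y u \<Longrightarrow>
      precedes (insert_ext v A Q) v u"
proof -
  obtain xs ys where xy: "Q = xs @ ys" "insert_ext v A Q = xs @ (Exists, v) # ys"
    and least: "\<And>xs' ys'. Q = xs' @ ys' \<Longrightarrow> fvars A \<subseteq> prefix_vars xs' \<Longrightarrow> length xs \<le> length xs'"
    using insert_ext_split[OF assms(1)] by metis
  show "prefix_vars (insert_ext v A Q) = insert v (prefix_vars Q)"
    "universals (insert_ext v A Q) = universals Q"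
    "distinct (map snd (insert_ext v A Q))"
    using xy assms(2,3) by (auto simp: universals_def prefix_vars_def)
  show "precedes (insert_ext v A Q) y z" if pre: "precedes Q y z"
  proof -
    obtain as bs where ab: "Q = as @ bs" "y \<in> prefix_vars as" "z \<in> prefix_vars bs"
      using pre precedes_iff_split by auto
    \<comment> \<open>The cut between \<open>y\<close> and \<open>z\<close> falls into
      \<open>xs\<close> or into \<open>ys\<close>; \<open>v\<close> joins whichever side contains
      the insertion point.\<close>
    then obtain us where "xs = as @ us \<and> us @ ys = bs \<or> xs @ us = as \<and> ys = us @ bs"
      using xy(1) by (auto simp: append_eq_append_conv2)
    then show ?thesis
    proof
      assume "xs = as @ us \<and> us @ ys = bs"
      then show ?thesis using ab xy(2) unfolding precedes_iff_split
        by (intro exI[of _ as] exI[of _ "us @ (Exists, v) # ys"]) auto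
    next
      assume "xs @ us = as \<and> ys = us @ bs"
      then show ?thesis using ab xy(2) unfolding precedes_iff_split
        by (intro exI[of _ "xs @ (Exists, v) # us"] exI[of _ bs]) auto
    qed
  qed
  show "precedes (insert_ext v A Q) v u" if u: "u \<in> prefix_vars Q" "\<forall>y\<in>fvars A. precedes Q y u"
  proof -
    obtain j where j: "j < length Q" "u = snd (Q ! j)"
      using u(1) by (auto simp: prefix_vars_def in_set_conv_nth)
    \<comment> \<open>The segment in front of \<open>u\<close> already contains all variables of
      \<open>A\<close>, so by minimality the insertion point does not lie beyond it.\<close>
    have "fvars A \<subseteq> prefix_vars (take j Q)"
    proof
      fix y assume "y \<in> fvars A"
      then obtain i where "i < j" "snd (Q ! i) = y"
        using u(2) j precedes_index[OF assms(3)] by auto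
      moreover from this have "Q ! i \<in> set (take j Q)"
        using j by (auto simp: in_set_conv_nth intro!: exI[of _ i])
      ultimately show "y \<in> prefix_vars (take j Q)" by (auto simp: prefix_vars_def)
    qed
    then have "length xs \<le> j" using least[of "take j Q" "drop j Q"] j(1) by simp
    then have "u = snd (ys ! (j - length xs))" "j - length xs < length ys"
      using j xy(1) by (auto simp: nth_append)
    then have "u \<in> prefix_vars ys" by (auto simp: prefix_vars_def)
    then show ?thesis using xy(2) unfolding precedes_iff_split
      by (intro exI[of _ "xs @ [(Exists, v)]"] exI[of _ ys]) simp
  qed
qed

text \<open>\<open>owner v\<close> is the variable that \<open>v\<close> must stay left of. A
  definition mentions only variables left of the owner and earlier extension variables with the same
  owner; the latter have by then been placed left of it too, so the insertion point of
  \<open>v\<close> is left of the owner.\<close>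

lemma efrege_extensions:
  fixes def :: "var \<Rightarrow> form" and owner :: "var \<Rightarrow> var"
  assumes "distinct (map snd Q)" "distinct vs" "set vs \<inter> prefix_vars Q = {}"
    and "\<And>v. v \<in> set vs \<Longrightarrow> owner v \<in> prefix_vars Q"
    and "\<And>xs v ys y. vs = xs @ v # ys \<Longrightarrow> y \<in> fvars (def v) \<Longrightarrow>
           precedes Q y (owner v) \<or> y \<in> set xs \<and> owner y = owner v"
  shows "\<exists>Q'. efrege F Q \<phi> Q' (map (\<lambda>v. Iff_f (Var v) (def v)) vs) \<and>
           prefix_vars Q' = prefix_vars Q \<union> set vs \<and> universals Q' = universals Q \<and>
           distinct (map snd Q') \<and> (\<forall>y z. precedes Q y z \<longrightarrow> precedes Q' y z) \<and>
           (\<forall>v\<in>set vs. precedes Q' v (owner v))"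
  using assms(2-)
proof (induction vs rule: rev_induct)
  case Nil
  then show ?case using assms(1) by (auto intro: efrege.start)
next
  case (snoc v vs)
  have dep: "\<And>xs v ys y. vs = xs @ v # ys \<Longrightarrow> y \<in> fvars (def v) \<Longrightarrow>
      precedes Q y (owner v) \<or> y \<in> set xs \<and> owner y = owner v"
    using snoc.prems(4) by (metis append.assoc append_Cons)
  then obtain Q' where Q': "efrege F Q \<phi> Q' (map (\<lambda>v. Iff_f (Var v) (def v)) vs)"
    "prefix_vars Q' = prefix_vars Q \<union> set vs" "universals Q' = universals Q" "distinct (map snd Q')"
    "\<forall>y z. precedes Q y z \<longrightarrow> precedes Q' y z" "\<forall>v\<in>set vs. precedes Q' v (owner v)"
    using snoc.IH snoc.prems(1-3) by auto
  have dep_v: "precedes Q y (owner v) \<or> y \<in> set vs \<and> owner y = owner v" if "y \<in> fvars (def v)" for y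
    using snoc.prems(4)[of vs v "[]"] that by simp
  have fv: "fvars (def v) \<subseteq> prefix_vars Q'"
    using dep_v Q'(2) precedes_in_prefix by fast
  have v: "v \<notin> prefix_vars Q'" using snoc.prems(1,2) Q'(2) by auto
  \<comment> \<open>The extension rule forbids \<open>v\<close> in earlier lines. These mention only
    variables of \<open>Q\<close> and members of \<open>vs\<close>.\<close>
  have fresh: "v \<notin> fvars (def w)" if "w \<in> set vs" for w
  proof
    assume *: "v \<in> fvars (def w)"
    obtain xs ys where "vs = xs @ w # ys" using split_list \<open>w \<in> set vs\<close> by metis
    from dep[OF this *] show False
      using snoc.prems(1,2) precedes_in_prefix \<open>vs = xs @ w # ys\<close> by fastforce
  qed
  let ?Q = "insert_ext v (def v) Q'"
  note ext = insert_ext_properties[OF fv v Q'(4)]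
  have "precedes Q' y (owner v)" if "y \<in> fvars (def v)" for y
    using dep_v[OF that] Q'(5,6) by metis
  then have new: "precedes ?Q v (owner v)"
    using snoc.prems(3)[of v] Q'(2) by (intro ext(5)) auto
  have "efrege F Q \<phi> ?Q (map (\<lambda>v. Iff_f (Var v) (def v)) vs @ [Iff_f (Var v) (def v)])"
    using fv v fresh snoc.prems(1) by (intro efrege.extension[OF Q'(1)]) auto
  then show ?case using ext new Q' by (intro exI[of _ ?Q]) auto
qed


section \<open>Elimination of universal variables\<close>

context frege_simulation
begin

text \<open>\<open>us\<close> runs from right to left in the prefix. Reduction of its head
  \<open>u\<close> is legal because every other variable of the disjunction is left of
  \<open>u\<close>: the remaining universals by the order of \<open>us\<close>, and each strategy
  variable because it is left of its own universal.\<close>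

lemma dv_reduce_mismatches:
  assumes "distinct (map snd Q')"
    and "sorted_wrt (\<lambda>u u'. precedes Q' u' u) us" "set us \<subseteq> universals Q'"
    and "\<forall>u\<in>set us. precedes Q' (t u) u"
    and "dis (map (\<lambda>u. mismatch (Var u) (Var (t u))) us) \<in> \<Gamma>"
    and "ok (dis (map (\<lambda>u. mismatch (Var u) (Var (t u))) us))"
  shows "dv (3 * length us) \<Gamma> {Fls}"
  using assms(2-)
proof (induction us arbitrary: \<Gamma>)
  case Nil
  then show ?case by (auto intro: dv_refl)
next
  case (Cons u us)
  let ?R = "dis (map (\<lambda>u. mismatch (Var u) (Var (t u))) us)"
  let ?A = "Or_f (mismatch (Var u) (Var (t u))) ?R"
  have tu: "precedes Q' (t u) u" using Cons.prems by simp
  have R_pre: "precedes Q' y u" if y: "y \<in> fvars ?R" for y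
  proof -
    obtain u' where u': "u' \<in> set us" "y = u' \<or> y = t u'"
      using y by (auto simp: fvars_dis)
    then have "precedes Q' u' u" "precedes Q' (t u') u'" using Cons.prems by auto
    then show ?thesis using u'(2) precedes_trans[OF assms(1)] by blast
  qed
  have pre: "\<not> precedes Q' u y" if "y \<in> fvars ?A" for y
  proof -
    have "y = u \<or> precedes Q' y u" using that tu R_pre by auto
    then show ?thesis using precedes_trans[OF assms(1)] precedes_irrefl[OF assms(1)] by blast
  qed
  \<comment> \<open>Hence the substituted constant shows up only as the left side of the first
    mismatch.\<close>
  have "u \<notin> fvars ?R" "t u \<noteq> u" using R_pre tu precedes_irrefl[OF assms(1)] by auto
  then have subst: "fsubst (Var(u := b)) ?A = Or_f (mismatch b (Var (t u))) ?R" for b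
    by (simp add: fsubst_fresh)
  have ok: "ok ?R" "ok (Var (t u))" using Cons.prems(5) by (auto simp: bounded_form_def N_ge_1)
  have red: "dv 1 \<Delta> {Or_f (mismatch b (Var (t u))) ?R}" if "b \<in> {Fls, Tru}" "\<Gamma> \<subseteq> \<Delta>" for b \<Delta>
  proof -
    have "dv 1 \<Delta> {fsubst (Var(u := b)) ?A}"
      using that pre Cons.prems by (intro dv_reduction) auto
    then show ?thesis by (simp only: subst)
  qed
  have "dv 1 (\<Gamma> \<union> {Or_f (mismatch Fls (Var (t u))) ?R} \<union> {Or_f (mismatch Tru (Var (t u))) ?R}) {?R}"
    by (rule dv_drop_mismatch[of "Var (t u)"]) (use ok in auto)
  with red[of Tru] have "dv 2 (\<Gamma> \<union> {Or_f (mismatch Fls (Var (t u))) ?R}) {?R}"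
    by (rule dv_cut) auto
  with red[of Fls] have "dv 3 \<Gamma> {?R}" by (rule dv_cut) auto
  moreover have "dv (3 * length us) (\<Gamma> \<union> {?R}) {Fls}"
    by (rule Cons.IH) (use Cons.prems ok in auto)
  ultimately show ?case by (rule dv_cut) simp
qed

end


section \<open>Merge Resolution proofs\<close>

lemma select_SomeD:
  "select M N = Some K \<Longrightarrow> K = M \<and> (trivial N \<or> isomorphic M N) \<or> K = N \<and> trivial M"
  by (auto simp: select_def split: if_splits)

lemma root_in_dom: "finite (dom M) \<Longrightarrow> \<not> trivial M \<Longrightarrow> root M \<in> dom M"
  unfolding root_def by (rule Max_in) auto

locale mres_proof =
  fixes Q :: prefix and \<phi> :: cnf and \<pi> :: "mres_line list"
  assumes closed: "closed_pcnf Q \<phi>" and refutation: "mres_refutation Q \<phi> \<pi>"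
begin

abbreviation mm :: "nat \<Rightarrow> var \<Rightarrow> merge_map" where
  "mm i u \<equiv> snd (\<pi> ! i) u"

abbreviation lits :: "nat \<Rightarrow> literal set" where
  "lits i \<equiv> fst (\<pi> ! i)"

abbreviation active :: "nat \<Rightarrow> var set" where
  "active i \<equiv> {u \<in> universals Q. \<not> trivial (mm i u)}"

lemma wf_line: "i < length \<pi> \<Longrightarrow> mres_wf_line Q i (\<pi> ! i)"
  using refutation unfolding mres_refutation_def by blast

lemma line_cases:
  assumes "i < length \<pi>"
  obtains "mres_axiom Q \<phi> i (\<pi> ! i)"
  | j k x where "j < i" "k < i" "mres_resolution Q i x (\<pi> ! j) (\<pi> ! k) (\<pi> ! i)"
  using assms refutation unfolding mres_refutation_def by blast

lemma dom_mm:
  assumes "i < length \<pi>" "u \<in> universals Q"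
  shows "dom (mm i u) \<subseteq> {0..i}" and "finite (dom (mm i u))"
proof -
  show "dom (mm i u) \<subseteq> {0..i}"
    using wf_line[OF assms(1)] assms(2) unfolding mres_wf_line_def wf_merge_map_def by blast
  then show "finite (dom (mm i u))" by (rule finite_subset) simp
qed

lemma wf_node:
  assumes "i < length \<pi>" "u \<in> universals Q" "mm i u a = Some (Node x b c)"
  shows "x \<in> existentials Q \<and> precedes Q x u \<and> b \<in> dom (mm i u) \<and> c \<in> dom (mm i u) \<and> b < a \<and> c < a"
  using wf_line[OF assms(1)] assms(2,3) unfolding mres_wf_line_def wf_merge_map_def by blast

lemma lits_existential: "i < length \<pi> \<Longrightarrow> l \<in> lits i \<Longrightarrow> lvar l \<in> existentials Q"
  using wf_line unfolding mres_wf_line_def by blast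

section \<open>Merge maps along a proof\<close>

lemma axiom_map:
  assumes "mres_axiom Q \<phi> i (\<pi> ! i)" "u \<in> universals Q"
  shows "trivial (mm i u) \<or> (\<exists>b. mm i u = [i \<mapsto> Leaf b])"
  using assms unfolding mres_axiom_def by metis

lemma resolution_map:
  assumes "mres_resolution Q i x (\<pi> ! j) (\<pi> ! k) (\<pi> ! i)" "u \<in> universals Q"
  obtains "mm i u = mm j u" "trivial (mm k u) \<or> isomorphic (mm j u) (mm k u)"
  | "mm i u = mm k u" "trivial (mm j u)"
  | "\<not> trivial (mm j u)" "\<not> trivial (mm k u)" "consistent (mm j u) (mm k u)"
    "mm i u = merge i x (mm j u) (mm k u)"
proof -
  have "select (mm j u) (mm k u) = Some (mm i u) \<or>
      \<not> trivial (mm j u) \<and> \<not> trivial (mm k u) \<and> consistent (mm j u) (mm k u) \<and>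
      mm i u = merge i x (mm j u) (mm k u)"
    using assms unfolding mres_resolution_def by blast
  then show thesis using select_SomeD[of "mm j u" "mm k u" "mm i u"] that by argo
qed

text \<open>A new node arises only in an axiom or by a Merge and receives the number of its line,
  while existing nodes keep their values. So universal and node number alone determine the value,
  which is what allows one extension variable to serve all lines.\<close>

lemma node_value:
  "i < length \<pi> \<Longrightarrow> u \<in> universals Q \<Longrightarrow> mm i u a = Some v \<Longrightarrow> a \<le> i \<and> mm a u a = Some v"
proof (induction i rule: less_induct)
  case (less i)
  show ?case
  proof (rule line_cases[OF less.prems(1)])
    assume "mres_axiom Q \<phi> i (\<pi> ! i)"
    from axiom_map[OF this less.prems(2)] show ?thesis
      using less.prems(3) by (auto split: if_splits)
  next
    fix j k x
    assume jk: "j < i" "k < i" and res: "mres_resolution Q i x (\<pi> ! j) (\<pi> ! k) (\<pi> ! i)"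
    have IH: "a \<le> i \<and> mm a u a = Some v" if "mm j u a = Some v \<or> mm k u a = Some v"
      using that less.IH[of j] less.IH[of k] jk less.prems(1,2) by force
    from res less.prems(2) show ?thesis
    proof (cases rule: resolution_map)
      case 3
      then have "a = i \<or> (mm j u ++ mm k u) a = Some v"
        using less.prems(3) by (auto simp: merge_def split: if_splits)
      then show ?thesis using IH less.prems(3) by (auto simp: map_add_Some_iff)
    qed (use IH less.prems(3) in simp_all)
  qed
qed

text \<open>The bias of \<open>++\<close> towards its right argument is harmless, because both maps
  give a common node the value it had in the line creating it.\<close>

lemma merged_value:
  assumes "j < length \<pi>" "k < length \<pi>" "u \<in> universals Q"
    "mm j u a = Some v \<or> mm k u a = Some v"
  shows "(mm j u ++ mm k u) a = Some v"
  using assms node_value[of j u a] node_value[of k u a]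
  by (cases "mm k u a") (auto simp: map_add_def)

lemma root_merge:
  assumes "i < length \<pi>" "j < i" "k < i" "u \<in> universals Q"
  shows "root (merge i x (mm j u) (mm k u)) = i"
  unfolding root_def
proof (rule Max_eqI)
  show "finite (dom (merge i x (mm j u) (mm k u)))"
    using assms dom_mm(2) by (auto simp: merge_def)
  fix a assume "a \<in> dom (merge i x (mm j u) (mm k u))"
  then show "a \<le> i"
    using assms dom_mm(1)[of j u] dom_mm(1)[of k u] by (force simp: merge_def split: if_splits)
qed (simp add: merge_def)

text \<open>A Merge turns the two old roots into children of the new one, and all other nodes keep
  their parents. This ties the root, defined as the largest node, to the shape of the map, which
  isomorphisms preserve.\<close>

lemma nonroot_has_parent:
  "i < length \<pi> \<Longrightarrow> u \<in> universals Q \<Longrightarrow> a \<in> dom (mm i u) \<Longrightarrow> a \<noteq> root (mm i u) \<Longrightarrow>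
   \<exists>p x b c. mm i u p = Some (Node x b c) \<and> (a = b \<or> a = c)"
proof (induction i rule: less_induct)
  case (less i)
  show ?case
  proof (rule line_cases[OF less.prems(1)])
    assume "mres_axiom Q \<phi> i (\<pi> ! i)"
    from axiom_map[OF this less.prems(2)] show ?thesis
      using less.prems(3,4) by (auto simp: root_def)
  next
    fix j k x
    assume jk: "j < i" "k < i" and res: "mres_resolution Q i x (\<pi> ! j) (\<pi> ! k) (\<pi> ! i)"
    have len: "j < length \<pi>" "k < length \<pi>" using jk less.prems(1) by auto
    from res less.prems(2) show ?thesis
    proof (cases rule: resolution_map)
      case 3
      have i: "mm i u i = Some (Node x (root (mm j u)) (root (mm k u)))"
        by (simp add: 3 merge_def)
      have "a \<noteq> i"
        using less.prems(4) root_merge[OF less.prems(1) jk less.prems(2), of x] 3 by simp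
      then have "a \<in> dom (mm j u) \<or> a \<in> dom (mm k u)"
        using less.prems(3) 3 by (auto simp: merge_def)
      then consider "a = root (mm j u) \<or> a = root (mm k u)"
        | p y b c where "mm j u p = Some (Node y b c) \<or> mm k u p = Some (Node y b c)" "a = b \<or> a = c"
        using less.IH[OF jk(1) len(1) less.prems(2)] less.IH[OF jk(2) len(2) less.prems(2)] by blast
      then show ?thesis
      proof cases
        case 1
        then show ?thesis using i by blast
      next
        case 2
        have "p \<noteq> i" using 2(1) node_value[OF len(1) less.prems(2)]
            node_value[OF len(2) less.prems(2)] jk by fastforce
        then have "mm i u p = Some (Node y b c)"
          using merged_value[OF len less.prems(2) 2(1)] 3 by (simp add: merge_def)
        then show ?thesis using 2(2) by blast
      qed
    qed (use less.IH[OF jk(1) len(1) less.prems(2)] less.IH[OF jk(2) len(2) less.prems(2)]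
        less.prems(3,4) in simp_all)
  qed
qed

text \<open>If a node other than the root of \<open>mm j u\<close> were mapped to the root of
  \<open>mm k u\<close>, the image of its parent would have that root as a child. A parent exceeds
  its children, but nothing exceeds the largest node.\<close>

lemma isomorphism_root:
  assumes "j < length \<pi>" "k < length \<pi>" "u \<in> universals Q" "\<not> trivial (mm k u)"
    and f: "bij_betw f (dom (mm j u)) (dom (mm k u))"
      "\<And>a x b c. mm j u a = Some (Node x b c) \<Longrightarrow> mm k u (f a) = Some (Node x (f b) (f c))"
  shows "f (root (mm j u)) = root (mm k u)"
proof (rule ccontr)
  assume neq: "f (root (mm j u)) \<noteq> root (mm k u)"
  have "root (mm k u) \<in> dom (mm k u)"
    using assms(2-4) dom_mm(2) by (intro root_in_dom)
  then obtain a where a: "a \<in> dom (mm j u)" "f a = root (mm k u)"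
    using f(1) unfolding bij_betw_def by (metis imageE)
  then have "a \<noteq> root (mm j u)" using neq by auto
  then obtain p x b c where p: "mm j u p = Some (Node x b c)" "a = b \<or> a = c"
    using nonroot_has_parent a assms by blast
  have "f p \<le> root (mm k u)"
    unfolding root_def using f(2)[OF p(1)] dom_mm(2)[OF assms(2,3)] by (intro Max_ge) auto
  moreover have "root (mm k u) < f p"
    using wf_node[OF assms(2,3) f(2)[OF p(1)]] p(2) a(2) by auto
  ultimately show False by simp
qed

section \<open>Size of the lines of a proof\<close>

abbreviation S :: nat where
  "S \<equiv> mres_size Q \<pi>"

lemma size_eq:
  "S = (\<Sum>i<length \<pi>. 1 + card (lits i) + (\<Sum>u\<in>universals Q. card (dom (mm i u))))"
  unfolding mres_size_def by (simp add: sum_list_sum_nth atLeast0LessThan)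

lemma length_le_size: "length \<pi> \<le> S"
proof -
  have "(\<Sum>i<length \<pi>. 1) \<le> S" unfolding size_eq by (rule sum_mono) simp
  then show ?thesis by simp
qed

lemma line_le_size:
  assumes "i < length \<pi>"
  shows "card (lits i) + (\<Sum>u\<in>universals Q. card (dom (mm i u))) \<le> S"
proof -
  have "1 + card (lits i) + (\<Sum>u\<in>universals Q. card (dom (mm i u))) \<le> S"
    unfolding size_eq using assms
    by (intro member_le_sum[where f="\<lambda>i. 1 + card (lits i) + (\<Sum>u\<in>universals Q. card (dom (mm i u)))"])
      auto
  then show ?thesis by simp
qed

lemma card_active_le:
  assumes "i < length \<pi>"
  shows "card (active i) \<le> (\<Sum>u\<in>universals Q. card (dom (mm i u)))"
proof -
  have "card (active i) = (\<Sum>u\<in>active i. 1)" by simp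
  also have "\<dots> \<le> (\<Sum>u\<in>active i. card (dom (mm i u)))"
    using dom_mm(2)[OF assms] by (intro sum_mono) (simp add: Suc_le_eq card_gt_0_iff)
  also have "\<dots> \<le> (\<Sum>u\<in>universals Q. card (dom (mm i u)))"
    using finite_universals by (intro sum_mono2) auto
  finally show ?thesis .
qed

text \<open>The existential literals of the clause are counted in the line itself. Each universal
  literal is paid for by the nontrivial map of its variable, and no universal variable accounts for
  two literals, since its leaf would have to carry both constants.\<close>

lemma axiom_clause_length:
  assumes "i < length \<pi>" "C \<in> set \<phi>" "lits i = {l \<in> set C. lvar l \<in> existentials Q}"
    and "\<And>u. u \<in> universals Q \<Longrightarrow> Pos u \<in> set C \<Longrightarrow> mm i u = [i \<mapsto> Leaf False]"
    and "\<And>u. u \<in> universals Q \<Longrightarrow> Neg u \<in> set C \<Longrightarrow> mm i u = [i \<mapsto> Leaf True]"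
  shows "length C \<le> S"
proof -
  let ?E = "{l \<in> set C. lvar l \<in> existentials Q}" and ?U = "{l \<in> set C. lvar l \<in> universals Q}"
  have C: "distinct C" "lvar ` set C \<subseteq> prefix_vars Q"
    using closed assms(2) unfolding closed_pcnf_def by auto
  have noncompl: "\<not> (Pos u \<in> set C \<and> Neg u \<in> set C)" if "u \<in> universals Q" for u
  proof
    assume "Pos u \<in> set C \<and> Neg u \<in> set C"
    then have "[i \<mapsto> Leaf False] = [i \<mapsto> Leaf True]" using assms(4,5)[OF that] by simp
    from fun_cong[OF this, of i] show False by simp
  qed
  have "inj_on lvar ?U"
  proof (rule inj_onI)
    fix l l' assume "l \<in> ?U" "l' \<in> ?U" "lvar l = lvar l'"
    then show "l = l'" using noncompl by (cases l; cases l') auto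
  qed
  moreover have "lvar ` ?U \<subseteq> active i"
  proof
    fix u assume "u \<in> lvar ` ?U"
    then obtain l where l: "l \<in> set C" "lvar l = u" "u \<in> universals Q" by blast
    then obtain b where "mm i u = [i \<mapsto> Leaf b]" using assms(4,5) by (metis literal.exhaust lvar.simps)
    then show "u \<in> active i" using l(3) by simp
  qed
  ultimately have "card ?U \<le> card (active i)"
    using finite_universals card_mono[of "active i" "lvar ` ?U"] by (simp add: card_image)
  moreover have "card (set C) \<le> card ?E + card ?U"
  proof -
    have "set C = ?E \<union> ?U" using C(2) by (auto simp: prefix_vars_eq)
    from arg_cong[OF this, of card] show ?thesis using card_Un_le[of ?E ?U] by linarith
  qed
  ultimately show ?thesis
    using distinct_card[OF C(1)] card_active_le[OF assms(1)] line_le_size[OF assms(1)] assms(3) by simp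
qed

end


section \<open>The simulation\<close>

text \<open>Origin of \<open>N\<close>: a mismatch of two variables has size 4, hence costs 5 with
  its connective; the final \<open>Fls\<close> costs 1, and an implication from a literal of the
  pivot at most 3 more. The summand 10 is the size of the largest extension axiom.\<close>

locale mres_simulation = mres_proof Q \<phi> \<pi> + frege_simulation F Q \<phi> Q' c N
  for F :: "rule_schema set" and Q :: prefix and \<phi> :: cnf and \<pi> :: "mres_line list"
    and Q' :: prefix and c N :: nat +
  fixes s :: "var \<Rightarrow> nat \<Rightarrow> var"
  assumes prefix_vars_subset: "prefix_vars Q \<subseteq> prefix_vars Q'"
    and node_var: "i < length \<pi> \<Longrightarrow> u \<in> universals Q \<Longrightarrow> a \<in> dom (mm i u) \<Longrightarrow> s u a \<in> prefix_vars Q'"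
    and N_def: "N = 5 * S + 10"
begin

definition extension_axioms :: "form set" where
  "extension_axioms = {Iff_f (Var (s u a)) (node_form (s u) v) |u a v.
     a < length \<pi> \<and> u \<in> universals Q \<and> mm a u a = Some v}"

lemma extension_axiom:
  assumes "i < length \<pi>" "u \<in> universals Q" "mm i u a = Some v"
  shows "Iff_f (Var (s u a)) (node_form (s u) v) \<in> extension_axioms"
  using node_value[OF assms] assms unfolding extension_axioms_def by fastforce

section \<open>Lines as disjunctions\<close>

definition strategy_var :: "nat \<Rightarrow> var \<Rightarrow> var" where
  "strategy_var i u = s u (root (mm i u))"

definition disjuncts :: "nat \<Rightarrow> form set" where
  "disjuncts i = lit_form ` lits i \<union> (\<lambda>u. mismatch (Var u) (Var (strategy_var i u))) ` active i"

text \<open>The order may be arbitrary, because the inference steps reach a line only through its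
  members; a particular order is imposed just before the final reductions.\<close>

definition disjunct_list :: "nat \<Rightarrow> form list" where
  "disjunct_list i = (SOME L. distinct L \<and> set L = disjuncts i)"

lemma finite_active: "finite (active i)"
  using finite_universals by simp

lemma finite_lits: "i < length \<pi> \<Longrightarrow> finite (lits i)"
  using wf_line unfolding mres_wf_line_def by blast

lemma disjunct_list:
  assumes "i < length \<pi>"
  shows "set (disjunct_list i) = disjuncts i" and "length (disjunct_list i) \<le> S"
proof -
  have "finite (disjuncts i)"
    unfolding disjuncts_def using finite_lits[OF assms] finite_active by simp
  from finite_distinct_list[OF this]
  have L: "distinct (disjunct_list i) \<and> set (disjunct_list i) = disjuncts i"
    unfolding disjunct_list_def by (rule_tac someI_ex) auto
  then show "set (disjunct_list i) = disjuncts i" by simp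
  have "length (disjunct_list i) = card (disjuncts i)" using L distinct_card by metis
  also have "\<dots> \<le> card (lits i) + card (active i)"
    unfolding disjuncts_def using finite_lits[OF assms] finite_active
    by (intro order_trans[OF card_Un_le] add_mono card_image_le)
  finally show "length (disjunct_list i) \<le> S"
    using card_active_le[OF assms] line_le_size[OF assms] by simp
qed

lemma ok_disI:
  assumes "length L \<le> S" "\<And>A. A \<in> set L \<Longrightarrow> fvars A \<subseteq> prefix_vars Q' \<and> fsize A \<le> 4"
  shows "ok (dis L)" "x \<in> prefix_vars Q' \<Longrightarrow> ok (Imp_f (Var x) (dis L))"
    "x \<in> prefix_vars Q' \<Longrightarrow> ok (Imp_f (Neg_f (Var x)) (dis L))"
proof -
  have "fsize (dis L) \<le> 5 * S + 1"
    using fsize_dis_le[of L 4] assms by fastforce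
  moreover have "fvars (dis L) \<subseteq> prefix_vars Q'" using assms(2) by (auto simp: fvars_dis)
  ultimately show "ok (dis L)" "x \<in> prefix_vars Q' \<Longrightarrow> ok (Imp_f (Var x) (dis L))"
    "x \<in> prefix_vars Q' \<Longrightarrow> ok (Imp_f (Neg_f (Var x)) (dis L))"
    unfolding bounded_form_def N_def by auto
qed

lemma lit_form_bounded:
  "lvar l \<in> prefix_vars Q \<Longrightarrow> fvars (lit_form l) \<subseteq> prefix_vars Q' \<and> fsize (lit_form l) \<le> 4"
  using prefix_vars_subset by (cases l) auto

lemma universal_ok: "u \<in> universals Q \<Longrightarrow> u \<in> prefix_vars Q'"
  and existential_ok: "x \<in> existentials Q \<Longrightarrow> x \<in> prefix_vars Q'"
  using prefix_vars_subset by (auto simp: prefix_vars_eq)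

lemma root_in_dom_mm: "i < length \<pi> \<Longrightarrow> u \<in> active i \<Longrightarrow> root (mm i u) \<in> dom (mm i u)"
  using dom_mm(2) by (intro root_in_dom) auto

lemma strategy_var_ok: "i < length \<pi> \<Longrightarrow> u \<in> active i \<Longrightarrow> strategy_var i u \<in> prefix_vars Q'"
  unfolding strategy_var_def using root_in_dom_mm by (auto intro!: node_var)

lemma disjuncts_bounded:
  assumes "i < length \<pi>" "A \<in> disjuncts i"
  shows "fvars A \<subseteq> prefix_vars Q' \<and> fsize A \<le> 4"
  using assms(2) unfolding disjuncts_def
proof
  assume "A \<in> lit_form ` lits i"
  then show ?thesis using lits_existential[OF assms(1)] lit_form_bounded by (auto simp: prefix_vars_eq)
next
  assume "A \<in> (\<lambda>u. mismatch (Var u) (Var (strategy_var i u))) ` active i"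
  then obtain u where "u \<in> active i" "A = mismatch (Var u) (Var (strategy_var i u))" by blast
  then show ?thesis using strategy_var_ok[OF assms(1)] universal_ok by simp
qed

definition line_form :: "nat \<Rightarrow> form" where
  "line_form i = dis (disjunct_list i)"

lemma ok_line_form:
  assumes "i < length \<pi>"
  shows "ok (line_form i)" "x \<in> prefix_vars Q' \<Longrightarrow> ok (Imp_f (Var x) (line_form i))"
    "x \<in> prefix_vars Q' \<Longrightarrow> ok (Imp_f (Neg_f (Var x)) (line_form i))"
  unfolding line_form_def using disjunct_list[OF assms] disjuncts_bounded[OF assms]
  by (auto intro!: ok_disI)

section \<open>Simulation of axioms and resolution steps\<close>

lemma dv_line_intros:
  assumes "i < length \<pi>"
  shows "dv (S * S) \<Gamma> ((\<lambda>A. Imp_f A (line_form i)) ` disjuncts i)"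
  using dv_dis_intros[of "disjunct_list i" "S * S" \<Gamma>] ok_line_form(1)[OF assms]
    disjunct_list[OF assms] mult_le_mono[of "length (disjunct_list i)" S "length (disjunct_list i)" S]
  unfolding line_form_def by simp

text \<open>Every literal of the clause implies a disjunct of the line. An existential literal is
  one itself. A universal literal says that its variable differs from the leaf constant, as the leaf
  carries the value that falsifies the literal.\<close>

lemma dv_axiom:
  assumes i: "i < length \<pi>" and ax: "mres_axiom Q \<phi> i (\<pi> ! i)" and E: "extension_axioms \<subseteq> \<Gamma>"
  shows "dv (S * S + 3 * S + 3) \<Gamma> {line_form i}"
proof -
  let ?I = "(\<lambda>A. Imp_f A (line_form i)) ` disjuncts i"
  obtain C where C: "C \<in> set \<phi>" "lits i = {l \<in> set C. lvar l \<in> existentials Q}"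
    and pos: "\<And>u. u \<in> universals Q \<Longrightarrow> Pos u \<in> set C \<Longrightarrow> mm i u = [i \<mapsto> Leaf False]"
    and neg: "\<And>u. u \<in> universals Q \<Longrightarrow> Neg u \<in> set C \<Longrightarrow> mm i u = [i \<mapsto> Leaf True]"
    using ax unfolding mres_axiom_def by blast
  have len: "length C \<le> S" by (rule axiom_clause_length[OF i C pos neg])
  have vars: "lvar l \<in> prefix_vars Q" if "l \<in> set C" for l
    using closed C(1) that unfolding closed_pcnf_def by blast
  have okC: "ok (dis (map lit_form C))"
    by (rule ok_disI) (use len lit_form_bounded vars in auto)
  let ?\<Delta> = "\<Gamma> \<union> ?I \<union> {clause_form C}"
  have step: "dv 2 ?\<Delta> {Imp_f (lit_form l) (line_form i)}" if l: "l \<in> set C" for l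
  proof (cases "lvar l \<in> existentials Q")
    case True
    then show ?thesis using l C(2) by (intro dv_refl) (auto simp: disjuncts_def)
  next
    case False
    then have u: "lvar l \<in> universals Q" using vars[OF l] by (auto simp: prefix_vars_eq)
    obtain b where b: "mm i (lvar l) = [i \<mapsto> Leaf b]" "b \<longleftrightarrow> l = Neg (lvar l)"
      using u l pos neg by (cases l) auto
    have act: "lvar l \<in> active i" using u b by simp
    have "Iff_f (Var (s (lvar l) i)) (node_form (s (lvar l)) (Leaf b)) \<in> extension_axioms"
      using b by (intro extension_axiom[OF i u]) simp
    moreover have "strategy_var i (lvar l) = s (lvar l) i"
      using b by (simp add: strategy_var_def root_def)
    moreover have "Imp_f (mismatch (Var (lvar l)) (Var (strategy_var i (lvar l)))) (line_form i) \<in> ?I"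
      using act by (auto simp: disjuncts_def)
    ultimately have prem: "Iff_f (Var (strategy_var i (lvar l))) (if b then Tru else Fls) \<in> ?\<Delta>"
      "Imp_f (mismatch (Var (lvar l)) (Var (strategy_var i (lvar l)))) (line_form i) \<in> ?\<Delta>"
      using E by auto
    have "ok (Var (lvar l))" "ok (Var (strategy_var i (lvar l)))"
      using universal_ok[OF u] strategy_var_ok[OF i act] by auto
    note const = dv_mismatch_const[OF this ok_line_form(1)[OF i]]
    have "dv 1 ?\<Delta> {Imp_f (lit_form l) (line_form i)}"
    proof (cases l)
      case (Pos u)
      then show ?thesis using const(1) prem b(2) by simp
    next
      case (Neg u)
      then show ?thesis using const(2) prem b(2) by simp
    qed
    then show ?thesis by (rule dv_mono) auto
  qed
  have "dv 1 (\<Gamma> \<union> ?I) {clause_form C}"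
    using C(1) okC by (intro dv_clause) (auto simp: clause_form_dis)
  moreover have "dv (3 * S + 2) ?\<Delta> {line_form i}"
  proof (rule dv_mono[OF dv_dis_elim_steps[OF okC ok_line_form(1)[OF i]]])
    show "dis (map lit_form C) \<in> ?\<Delta>" by (simp add: clause_form_dis)
  qed (use step len in auto)
  ultimately have "dv (3 * S + 3) (\<Gamma> \<union> ?I) {line_form i}" by (rule dv_cut) simp
  with dv_line_intros[OF i] show ?thesis by (rule dv_cut) simp
qed

text \<open>At most \<open>S\<close> universals have a nontrivial map in line \<open>j\<close>, and
  each of them costs at most \<open>S\<close> steps because node numbers are smaller than the number
  of lines.\<close>

lemma dv_isomorphic_roots:
  assumes "j < length \<pi>" "k < length \<pi>" and E: "extension_axioms \<subseteq> \<Gamma>"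
  shows "dv (S * S) \<Gamma> ((\<lambda>u. Iff_f (Var (strategy_var j u)) (Var (strategy_var k u))) `
           {u \<in> active j. isomorphic (mm j u) (mm k u)})"
proof (rule dv_image)
  let ?U = "{u \<in> active j. isomorphic (mm j u) (mm k u)}"
  show "finite ?U" using finite_universals by simp
  have "card ?U \<le> card (active j)" using finite_universals by (intro card_mono) auto
  then show "card ?U * S \<le> S * S"
    using card_active_le[OF assms(1)] line_le_size[OF assms(1)] by (intro mult_le_mono1) linarith
  fix u assume u: "u \<in> ?U"
  then obtain f where f: "bij_betw f (dom (mm j u)) (dom (mm k u))"
    "\<And>a x b c. mm j u a = Some (Node x b c) \<Longrightarrow> mm k u (f a) = Some (Node x (f b) (f c))"
    "\<And>a t. mm j u a = Some (Leaf t) \<Longrightarrow> mm k u (f a) = Some (Leaf t)"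
    unfolding isomorphic_def by blast
  have uU: "u \<in> universals Q" using u by simp
  have root: "root (mm j u) \<in> dom (mm j u)" using u by (intro root_in_dom_mm assms(1)) simp
  have "\<not> trivial (mm k u)" using root f(1) by (auto simp: bij_betw_def)
  from isomorphism_root[OF assms(1,2) uU this f(1,2)]
  have froot: "f (root (mm j u)) = root (mm k u)" .
  have "dv S \<Gamma> {Iff_f (Var (s u a)) (Var (s u (f a))) |a. a \<in> dom (mm j u) \<and> a < S}"
  proof (rule dv_homomorphism[where M = "mm j u" and M' = "mm k u"])
    show "Iff_f (Var (s u a)) (node_form (s u) v) \<in> \<Gamma>" if "mm j u a = Some v" for a v
      using extension_axiom[OF assms(1) uU that] E by auto
    show "Iff_f (Var (s u a)) (node_form (s u) v) \<in> \<Gamma>" if "mm k u a = Some v" for a v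
      using extension_axiom[OF assms(2) uU that] E by auto
    show "s u a \<in> prefix_vars Q'" if "a \<in> dom (mm j u) \<union> dom (mm k u)" for a
      using node_var assms(1,2) uU that by blast
    show "x \<in> prefix_vars Q' \<and> b \<in> dom (mm j u) \<and> c \<in> dom (mm j u) \<and> b < a \<and> c < a"
      if "mm j u a = Some (Node x b c)" for a x b c
      using wf_node[OF assms(1) uU that] existential_ok by simp
  qed (use f in auto)
  moreover have "root (mm j u) < S"
    using root dom_mm(1)[OF assms(1) uU] assms(1) length_le_size by auto
  ultimately show "dv S \<Gamma> {Iff_f (Var (strategy_var j u)) (Var (strategy_var k u))}"
    using root by (elim dv_mono) (auto simp: strategy_var_def froot[symmetric])
qed

text \<open>If the pivot holds, a merged root agrees with the root of \<open>mm j u\<close>,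
  otherwise with that of \<open>mm k u\<close>; so a mismatch in the relevant premise is a mismatch
  in the conclusion. Select keeps the left one of two isomorphic maps, hence only disjuncts of line
  \<open>k\<close> use the equivalences \<open>?J\<close>.\<close>

lemma dv_resolution:
  assumes i: "i < length \<pi>" and jk: "j < i" "k < i"
    and res: "mres_resolution Q i x (\<pi> ! j) (\<pi> ! k) (\<pi> ! i)"
    and E: "extension_axioms \<subseteq> \<Gamma>" and prem: "line_form j \<in> \<Gamma>" "line_form k \<in> \<Gamma>"
  shows "dv (2 * S * S + 6 * S + 5) \<Gamma> {line_form i}"
proof -
  have len: "j < length \<pi>" "k < length \<pi>" using i jk by auto
  let ?I = "(\<lambda>A. Imp_f A (line_form i)) ` disjuncts i"
  let ?J = "(\<lambda>u. Iff_f (Var (strategy_var j u)) (Var (strategy_var k u))) `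
      {u \<in> active j. isomorphic (mm j u) (mm k u)}"
  let ?\<Delta> = "\<Gamma> \<union> ?I \<union> ?J"
  have lits: "Neg x \<in> lits j" "Pos x \<in> lits k" "lits i = lits j \<union> lits k - {Pos x, Neg x}"
    using res unfolding mres_resolution_def by auto
  \<comment> \<open>The rule removes both literals of the pivot from both premises. In the case that
    \<open>x\<close> holds, a literal \<open>Pos x\<close> in line \<open>j\<close> would be true
    and yet missing from the conclusion; clauses without complementary literals exclude this, and
    dually for line \<open>k\<close>.\<close>
  have taut: "Pos x \<notin> lits j" "Neg x \<notin> lits k"
    using lits(1,2) wf_line len unfolding mres_wf_line_def by blast+
  have x: "x \<in> prefix_vars Q'" using lits_existential[OF len(1) lits(1)] existential_ok by simp
  note ok_i = ok_line_form[OF i]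
  have weaken: "dv 2 ?\<Delta> {Imp_f A (Imp_f X (line_form i))}"
    if "A \<in> disjuncts i" "X \<in> {Var x, Neg_f (Var x)}" for A X
  proof -
    have "ok A" using disjuncts_bounded[OF i that(1)] by (auto simp: bounded_form_def N_def)
    moreover have "ok X" using that(2) x by (auto simp: bounded_form_def N_def)
    ultimately have "dv 1 ?\<Delta> {Imp_f A (Imp_f X (line_form i))}"
      using that(1) ok_i(1) by (intro dv_imp_weaken) auto
    then show ?thesis by (rule dv_mono) auto
  qed
  have merged: "Iff_f (Var (strategy_var i u)) (ite (Var x) (Var (strategy_var j u)) (Var (strategy_var k u)))
      \<in> extension_axioms"
    if "u \<in> universals Q" "mm i u = merge i x (mm j u) (mm k u)" for u
  proof -
    have "root (mm i u) = i" using root_merge[OF i jk that(1)] that(2) by simp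
    moreover have "Iff_f (Var (s u i)) (node_form (s u) (Node x (root (mm j u)) (root (mm k u))))
        \<in> extension_axioms"
      by (rule extension_axiom[OF i that(1)]) (simp add: that(2) merge_def)
    ultimately show ?thesis by (simp add: strategy_var_def)
  qed
  have strategy: "mismatch (Var u) (Var (strategy_var i u)) \<in> disjuncts i" if "u \<in> active i" for u
    using that by (simp add: disjuncts_def)
  have left: "dv 2 ?\<Delta> {Imp_f A (Imp_f (Var x) (line_form i))}" if A: "A \<in> disjuncts j" for A
    using A[unfolded disjuncts_def]
  proof
    assume "A \<in> lit_form ` lits j"
    then obtain l where l: "l \<in> lits j" "A = lit_form l" by blast
    show ?thesis
    proof (cases "l = Neg x")
      case True
      have "dv 1 ?\<Delta> {Imp_f A (Imp_f (Var x) (line_form i))}"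
        using l True x ok_i by (auto intro: dv_contradiction simp del: One_nat_def)
      then show ?thesis by (rule dv_mono) auto
    next
      case False
      then have "l \<in> lits i" using l(1) lits(3) taut(1) by auto
      then have "A \<in> disjuncts i" using l(2) unfolding disjuncts_def by blast
      then show ?thesis by (rule weaken) simp
    qed
  next
    assume "A \<in> (\<lambda>u. mismatch (Var u) (Var (strategy_var j u))) ` active j"
    then obtain u where u: "u \<in> active j" "A = mismatch (Var u) (Var (strategy_var j u))" by blast
    then have uU: "u \<in> universals Q" by simp
    from res uU show ?thesis
    proof (cases rule: resolution_map)
      case 1
      then have "A \<in> disjuncts i" using u strategy[of u] by (simp add: strategy_var_def)
      then show ?thesis by (rule weaken) simp
    next
      case 2
      then show ?thesis using u(1) by simp
    next
      case 3
      have act: "u \<in> active i" "u \<in> active k" using uU 3 by (auto simp: merge_def)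
      have "dv 1 ?\<Delta> {Imp_f A (Imp_f (Var x) (line_form i))}"
        unfolding u(2)
        by (rule dv_mismatch_ite(1)[of _ "Var (strategy_var i u)" _ "Var (strategy_var k u)"])
          (use merged[OF uU 3(4)] E act u(1) strategy_var_ok len i universal_ok[OF uU] x ok_i(1)
            strategy[OF act(1)] in auto)
      then show ?thesis by (rule dv_mono) auto
    qed
  qed
  have right: "dv 2 ?\<Delta> {Imp_f A (Imp_f (Neg_f (Var x)) (line_form i))}" if A: "A \<in> disjuncts k" for A
    using A[unfolded disjuncts_def]
  proof
    assume "A \<in> lit_form ` lits k"
    then obtain l where l: "l \<in> lits k" "A = lit_form l" by blast
    show ?thesis
    proof (cases "l = Pos x")
      case True
      have "dv 1 ?\<Delta> {Imp_f A (Imp_f (Neg_f (Var x)) (line_form i))}"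
        using l True x ok_i by (auto intro: dv_contradiction simp del: One_nat_def)
      then show ?thesis by (rule dv_mono) auto
    next
      case False
      then have "l \<in> lits i" using l(1) lits(3) taut(2) by auto
      then have "A \<in> disjuncts i" using l(2) unfolding disjuncts_def by blast
      then show ?thesis by (rule weaken) simp
    qed
  next
    assume "A \<in> (\<lambda>u. mismatch (Var u) (Var (strategy_var k u))) ` active k"
    then obtain u where u: "u \<in> active k" "A = mismatch (Var u) (Var (strategy_var k u))" by blast
    then have uU: "u \<in> universals Q" by simp
    from res uU show ?thesis
    proof (cases rule: resolution_map)
      case 1
      \<comment> \<open>The conclusion keeps the left map. As \<open>mm k u\<close> is nontrivial,
        the maps are isomorphic, and the mismatch with the root of \<open>mm k u\<close> has to be
        traced back to the root of \<open>mm j u\<close>.\<close>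
      then have iso: "isomorphic (mm j u) (mm k u)" using u(1) by simp
      then have "dom (mm k u) = {}" if "trivial (mm j u)"
        using that by (auto simp: isomorphic_def bij_betw_def)
      then have act: "u \<in> active j" using u(1) by auto
      have "dv 1 ?\<Delta> {Imp_f A (line_form i)}"
        unfolding u(2)
      proof (rule dv_mismatch_iff[of _ "Var (strategy_var j u)"])
        show "Imp_f (mismatch (Var u) (Var (strategy_var j u))) (line_form i) \<in> ?\<Delta>"
          using strategy[of u] 1(1) act by (simp add: strategy_var_def)
        show "Iff_f (Var (strategy_var j u)) (Var (strategy_var k u)) \<in> ?\<Delta>"
          using iso act by blast
      qed (use act u(1) strategy_var_ok len universal_ok[OF uU] ok_i(1) in auto)
      moreover have "dv 1 (?\<Delta> \<union> {Imp_f A (line_form i)})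
          {Imp_f A (Imp_f (Neg_f (Var x)) (line_form i))}"
      proof (rule dv_imp_weaken)
        show "ok A" using disjuncts_bounded[OF len(2) A] by (auto simp: bounded_form_def N_def)
        show "ok (Neg_f (Var x))" using x by (auto simp: bounded_form_def N_def)
      qed (use ok_i in auto)
      ultimately show ?thesis by (rule dv_cut) simp
    next
      case 2
      then have "A \<in> disjuncts i" using u strategy[of u] by (simp add: strategy_var_def)
      then show ?thesis by (rule weaken) simp
    next
      case 3
      have act: "u \<in> active i" "u \<in> active j" using uU 3 by (auto simp: merge_def)
      have "dv 1 ?\<Delta> {Imp_f A (Imp_f (Neg_f (Var x)) (line_form i))}"
        unfolding u(2)
        by (rule dv_mismatch_ite(2)[of _ "Var (strategy_var i u)" "Var (strategy_var j u)"])
          (use merged[OF uU 3(4)] E act u(1) strategy_var_ok len i universal_ok[OF uU] x ok_i(1)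
            strategy[OF act(1)] in auto)
      then show ?thesis by (rule dv_mono) auto
    qed
  qed
  have "dv (3 * length (disjunct_list j) + 3 * length (disjunct_list k) + 5) ?\<Delta> {line_form i}"
  proof (rule dv_resolve[of _ _ _ "Var x"])
    show "ok (dis (disjunct_list j))" "ok (dis (disjunct_list k))"
      "dis (disjunct_list j) \<in> ?\<Delta>" "dis (disjunct_list k) \<in> ?\<Delta>"
      using ok_line_form(1)[OF len(1)] ok_line_form(1)[OF len(2)] prem unfolding line_form_def by auto
  qed (use x ok_i left right disjunct_list(1) len in auto)
  then have main: "dv (6 * S + 5) ?\<Delta> {line_form i}"
    using disjunct_list(2)[OF len(1)] disjunct_list(2)[OF len(2)] by (elim dv_mono) auto
  have "dv (S * S) (\<Gamma> \<union> ?I) ?J" using E by (intro dv_isomorphic_roots len) auto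
  from dv_cut[OF this main] have "dv (S * S + 6 * S + 5) (\<Gamma> \<union> ?I) {line_form i}" by simp
  with dv_line_intros[OF i] show ?thesis by (rule dv_cut) simp
qed

text \<open>The cost of a line is that of a resolution step: S * S for the implications from its
  disjuncts, S * S for isomorphic roots, and 6 * S + 5 for the two cases of the pivot. An axiom
  stays below this.\<close>

lemma dv_lines:
  "n \<le> length \<pi> \<Longrightarrow> dv (n * (2 * S * S + 6 * S + 5)) extension_axioms (line_form ` {..<n})"
proof (induction n)
  case 0
  then show ?case by (simp add: dv_refl)
next
  case (Suc n)
  let ?\<Gamma> = "extension_axioms \<union> line_form ` {..<n}"
  have n: "n < length \<pi>" using Suc.prems by simp
  have "dv (2 * S * S + 6 * S + 5) ?\<Gamma> {line_form n}"
  proof (rule line_cases[OF n])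
    assume "mres_axiom Q \<phi> n (\<pi> ! n)"
    from dv_axiom[OF n this, of ?\<Gamma>] show ?thesis by (auto elim: dv_mono)
  next
    fix j k x assume "j < n" "k < n" "mres_resolution Q n x (\<pi> ! j) (\<pi> ! k) (\<pi> ! n)"
    then show ?thesis by (intro dv_resolution[OF n]) auto
  qed
  from dv_Un[OF Suc.IH[OF less_imp_le[OF n]] this]
  have "dv (Suc n * (2 * S * S + 6 * S + 5)) extension_axioms (line_form ` {..<n} \<union> {line_form n})"
    by simp
  then show ?case by (simp add: lessThan_Suc)
qed

lemma dv_refutation:
  assumes "distinct (map snd Q')" "universals Q' = universals Q"
    and pre: "\<And>y z. precedes Q y z \<Longrightarrow> precedes Q' y z"
    and node_pre: "\<And>i u a. i < length \<pi> \<Longrightarrow> u \<in> universals Q \<Longrightarrow> a \<in> dom (mm i u) \<Longrightarrow>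
      precedes Q' (s u a) u"
  shows "dv (S * (2 * S * S + 6 * S + 5) + (S * S + 4 * S + 2)) extension_axioms {Fls}"
proof -
  let ?n = "length \<pi> - 1" and ?m = "\<lambda>u. mismatch (Var u) (Var (strategy_var (length \<pi> - 1) u))"
  have last: "\<pi> \<noteq> []" "fst (last \<pi>) = {}" using refutation unfolding mres_refutation_def by auto
  then have n: "?n < length \<pi>" and no_lits: "lits ?n = {}" by (auto simp: last_conv_nth)
  \<comment> \<open>The reductions strip a disjunction from its head, which must belong to the
    rightmost universal. The last line has its disjuncts in arbitrary order, so it is first rebuilt
    along \<open>us\<close>.\<close>
  define us where "us = rev (filter (\<lambda>u. u \<in> active ?n) (map snd Q))"
  have set_us: "set us = active ?n"
    unfolding us_def by (force simp: universals_def)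
  have "distinct (map snd Q)" using closed unfolding closed_pcnf_def by blast
  then have "length us = card (active ?n)"
    using set_us distinct_card[of us] by (simp add: us_def)
  then have len: "length us \<le> S" using card_active_le[OF n] line_le_size[OF n] by simp
  have "sorted_wrt (precedes Q) (filter (\<lambda>u. u \<in> active ?n) (map snd Q))"
    by (rule sorted_wrt_filter[OF sorted_wrt_precedes])
  then have "sorted_wrt (precedes Q') (filter (\<lambda>u. u \<in> active ?n) (map snd Q))"
    using pre by (rule sorted_wrt_mono_rel[rotated])
  then have sorted: "sorted_wrt (\<lambda>u u'. precedes Q' u' u) us"
    unfolding us_def by (simp add: sorted_wrt_rev)
  have disj: "disjuncts ?n = set (map ?m us)" using set_us no_lits by (simp add: disjuncts_def)
  have okD: "ok (dis (map ?m us))"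
  proof (rule ok_disI)
    fix A assume "A \<in> set (map ?m us)"
    then show "fvars A \<subseteq> prefix_vars Q' \<and> fsize A \<le> 4"
      using disjuncts_bounded[OF n] disj by simp
  qed (use len in simp)
  have intros: "dv (S * S) (\<Gamma>) ((\<lambda>A. Imp_f A (dis (map ?m us))) ` set (map ?m us))" for \<Gamma>
    using len by (intro dv_dis_intros okD) (simp add: mult_le_mono)
  have "dv (3 * S) (\<Gamma> \<union> {dis (map ?m us)}) {Fls}" for \<Gamma>
  proof (rule dv_mono[OF dv_reduce_mismatches[OF assms(1) sorted]])
    show "\<forall>u\<in>set us. precedes Q' (strategy_var ?n u) u"
      unfolding strategy_var_def using set_us n root_in_dom_mm[OF n] by (auto intro!: node_pre)
  qed (use set_us assms(2) okD len in auto)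
  note reduce = this
  let ?\<Gamma> = "extension_axioms \<union> line_form ` {..<length \<pi>}"
  let ?I = "(\<lambda>A. Imp_f A (dis (map ?m us))) ` set (map ?m us)"
  have "dv (S + 2) (?\<Gamma> \<union> ?I) {dis (map ?m us)}"
  proof (rule dv_mono[OF dv_dis_elim[of "disjunct_list ?n"]])
    show "ok (dis (disjunct_list ?n))" using ok_line_form(1)[OF n] by (simp add: line_form_def)
    show "dis (disjunct_list ?n) \<in> ?\<Gamma> \<union> ?I" using n by (auto simp: line_form_def)
    show "\<forall>A\<in>set (disjunct_list ?n). Imp_f A (dis (map ?m us)) \<in> ?\<Gamma> \<union> ?I"
      using disjunct_list(1)[OF n] disj by blast
  qed (use disjunct_list(2)[OF n] okD in auto)
  from dv_cut[OF this reduce] have "dv (4 * S + 2) (?\<Gamma> \<union> ?I) {Fls}" by simp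
  from dv_cut[OF intros this] have "dv (S * S + 4 * S + 2) ?\<Gamma> {Fls}" by simp
  from dv_cut[OF dv_lines[OF order_refl] this] show ?thesis
    using mult_le_mono1[OF length_le_size, of "2 * S * S + 6 * S + 5"] by simp
qed

end

section \<open>Assembly of the refutation\<close>

lemma efrege_take: "efrege F Q \<phi> Q' ls \<Longrightarrow> \<exists>Q''. efrege F Q \<phi> Q'' (take n ls)"
proof (induction rule: efrege.induct)
  case start
  then show ?case by (auto intro: efrege.start)
next
  case (clause Q' ls C)
  have "efrege F Q \<phi> Q' (ls @ [clause_form C])" using clause by (intro efrege.clause)
  with clause.IH show ?case by (cases "n \<le> length ls") auto
next
  case (frege Q' ls Ps A \<sigma>)
  have "efrege F Q \<phi> Q' (ls @ [fsubst \<sigma> A])" using frege by (intro efrege.frege)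
  with frege.IH show ?case by (cases "n \<le> length ls") auto
next
  case (extension Q' ls A v)
  have "efrege F Q \<phi> (insert_ext v A Q') (ls @ [Iff_f (Var v) A])"
    using extension by (intro efrege.extension)
  with extension.IH show ?case by (cases "n \<le> length ls") auto
next
  case (reduction Q' ls A u b)
  have "efrege F Q \<phi> Q' (ls @ [fsubst (Var(u := b)) A])" using reduction by (intro efrege.reduction)
  with reduction.IH show ?case by (cases "n \<le> length ls") auto
qed

text \<open>The step bounds only guarantee that \<open>Fls\<close> occurs somewhere, whereas a
  refutation must end with it. Cutting the list behind the occurrence leaves a derivation and does
  not increase the size.\<close>

lemma efrege_refutationI:
  assumes "efrege F Q \<phi> Q' ls" "Fls \<in> set ls"
  obtains \<rho> where "efrege_refutation F Q \<phi> \<rho>" "efrege_size \<rho> \<le> efrege_size ls"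
proof -
  obtain xs ys where ls: "ls = xs @ Fls # ys" using assms(2) by (auto simp: in_set_conv_decomp)
  from efrege_take[OF assms(1), of "Suc (length xs)"] have "efrege_refutation F Q \<phi> (xs @ [Fls])"
    by (simp add: efrege_refutation_def ls)
  moreover have "efrege_size (xs @ [Fls]) \<le> efrege_size ls" by (simp add: efrege_size_def ls)
  ultimately show thesis using that by blast
qed

lemma fsize_node_form_le: "fsize (node_form t v) \<le> 8"
  by (cases v) auto

lemma (in mres_proof) efrege_simulation:
  assumes "1 \<le> c" and schema: "\<And>Ps A Q' N \<tau>. (Ps, A) \<in> set sim_rules \<Longrightarrow>
    \<forall>x. bounded_form Q' N (\<tau> x) \<Longrightarrow> derives F Q \<phi> Q' (c * N) c (fsubst \<tau> ` set Ps) {fsubst \<tau> A}"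
  shows "\<exists>\<rho>. efrege_refutation F Q \<phi> \<rho> \<and>
    efrege_size \<rho> \<le> (S + c * (S * (2 * S * S + 6 * S + 5) + (S * S + 4 * S + 2))) * (c * (5 * S + 10))"
proof -
  \<comment> \<open>Exceeds every variable of \<open>Q\<close>. Adding the code of a pair to it
    gives a fresh variable from which universal and node can be decoded.\<close>
  define base where "base = Suc (\<Sum>(prefix_vars Q))"
  define s where "s u a = base + prod_encode (u, a)" for u a
  define owner where "owner v = fst (prod_decode (v - base))" for v
  define index where "index v = snd (prod_decode (v - base))" for v
  \<comment> \<open>Every node also occurs in the line that created it, so it suffices to ask each
    line for the node with its own number. This yields at most one variable per line and universal
    with a nontrivial map.\<close>
  define X where "X = (\<Union>i<length \<pi>. (\<lambda>u. s u i) ` {u \<in> universals Q. i \<in> dom (mm i u)})"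
  \<comment> \<open>Children have smaller numbers than their parents, so sorting by node number
    places each definition behind those it refers to.\<close>
  define vs where "vs = sort_key index (sorted_list_of_set X)"
  define def where "def v = node_form (s (owner v)) (the (mm (index v) (owner v) (index v)))" for v
  have owner_s: "owner (s u a) = u" and index_s: "index (s u a) = a" for u a
    by (simp_all add: owner_def index_def s_def)
  have "finite X" unfolding X_def using finite_universals by auto
  then have vs: "set vs = X" "distinct vs" "sorted (map index vs)" by (simp_all add: vs_def)
  have fin: "finite (prefix_vars Q)" by (simp add: prefix_vars_def)
  have fresh: "set vs \<inter> prefix_vars Q = {}"
  proof -
    have "y < base" if "y \<in> prefix_vars Q" for y
      using member_le_sum[of y "prefix_vars Q" "\<lambda>y. y"] that fin by (simp add: base_def)
    moreover have "base \<le> v" if "v \<in> X" for v using that by (auto simp: X_def s_def)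
    ultimately show ?thesis using vs(1) by fastforce
  qed
  have X_I: "s u a \<in> X" if "i < length \<pi>" "u \<in> universals Q" "a \<in> dom (mm i u)" for i u a
    using node_value[OF that(1,2)] that unfolding X_def by fastforce
  have X_E: "\<exists>u a v'. v = s u a \<and> a < length \<pi> \<and> u \<in> universals Q \<and> mm a u a = Some v'"
    if "v \<in> X" for v
    using that unfolding X_def by blast
  have def_s: "def (s u a) = node_form (s u) v'" if "mm a u a = Some v'" for u a v'
    using that by (simp add: def_def owner_s index_s)
  have card_X: "card X \<le> S"
  proof -
    have "card X \<le> (\<Sum>i<length \<pi>. card ((\<lambda>u. s u i) ` {u \<in> universals Q. i \<in> dom (mm i u)}))"
      unfolding X_def by (rule card_UN_le) simp
    also have "\<dots> \<le> (\<Sum>i<length \<pi>. 1 + card (lits i) + (\<Sum>u\<in>universals Q. card (dom (mm i u))))"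
    proof (rule sum_mono)
      fix i assume "i \<in> {..<length \<pi>}"
      then have i: "i < length \<pi>" by simp
      have "card ((\<lambda>u. s u i) ` {u \<in> universals Q. i \<in> dom (mm i u)}) \<le>
          card {u \<in> universals Q. i \<in> dom (mm i u)}"
        using finite_universals by (intro card_image_le) simp
      also have "\<dots> \<le> card (active i)"
        using finite_universals by (intro card_mono) auto
      finally show "card ((\<lambda>u. s u i) ` {u \<in> universals Q. i \<in> dom (mm i u)}) \<le>
          1 + card (lits i) + (\<Sum>u\<in>universals Q. card (dom (mm i u)))"
        using card_active_le[OF i] by simp
    qed
    finally show ?thesis unfolding size_eq .
  qed
  have owner_in: "owner v \<in> prefix_vars Q" if "v \<in> set vs" for v
    using X_E[of v] that vs(1) by (auto simp: owner_s prefix_vars_eq)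
  have dep: "precedes Q y (owner v) \<or> y \<in> set xs \<and> owner y = owner v"
    if split: "vs = xs @ v # ys" and y: "y \<in> fvars (def v)" for xs v ys y
  proof -
    have "v \<in> X" using split vs(1) by auto
    then obtain u a v' where v: "v = s u a" "a < length \<pi>" "u \<in> universals Q" "mm a u a = Some v'"
      using X_E by blast
    obtain x b c where Node: "v' = Node x b c"
      using y v def_s by (cases v') (auto split: if_splits)
    note wf = wf_node[OF v(2,3) v(4)[unfolded Node]]
    have *: "s u d \<in> set xs" if "d \<in> dom (mm a u)" "d < a" for d
    proof -
      have "s u d \<in> set (xs @ v # ys)" using X_I[OF v(2,3) that(1)] vs(1) split by simp
      moreover have "s u d \<noteq> v" using that(2) v(1) index_s by (metis less_irrefl)
      moreover have "s u d \<notin> set ys"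
      proof
        assume "s u d \<in> set ys"
        then have "index v \<le> index (s u d)" using vs(3) split by (auto simp: sorted_append)
        then show False using that(2) v(1) by (simp add: index_s)
      qed
      ultimately show ?thesis by auto
    qed
    have "y = x \<or> y = s u b \<or> y = s u c" using y v Node def_s by auto
    then show ?thesis using wf * v(1) by (auto simp: owner_s)
  qed
  have "distinct (map snd Q)" using closed unfolding closed_pcnf_def by blast
  then have "\<exists>Q'. efrege F Q \<phi> Q' (map (\<lambda>v. Iff_f (Var v) (def v)) vs) \<and>
           prefix_vars Q' = prefix_vars Q \<union> set vs \<and> universals Q' = universals Q \<and>
           distinct (map snd Q') \<and> (\<forall>y z. precedes Q y z \<longrightarrow> precedes Q' y z) \<and>
           (\<forall>v\<in>set vs. precedes Q' v (owner v))"
    by (rule efrege_extensions) (use vs(2) fresh owner_in dep in auto)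
  then obtain Q' where Q': "efrege F Q \<phi> Q' (map (\<lambda>v. Iff_f (Var v) (def v)) vs)"
    "prefix_vars Q' = prefix_vars Q \<union> set vs" "universals Q' = universals Q" "distinct (map snd Q')"
    "\<And>y z. precedes Q y z \<Longrightarrow> precedes Q' y z" "\<And>v. v \<in> set vs \<Longrightarrow> precedes Q' v (owner v)"
    by blast
  let ?N = "5 * S + 10" and ?ls = "map (\<lambda>v. Iff_f (Var v) (def v)) vs"
  interpret mres_simulation F Q \<phi> \<pi> Q' c ?N s
    by unfold_locales (use assms Q'(2) X_I vs(1) in auto)
  have "extension_axioms \<subseteq> set ?ls"
  proof
    fix A assume "A \<in> extension_axioms"
    then obtain u a v' where A: "A = Iff_f (Var (s u a)) (node_form (s u) v')" "a < length \<pi>"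
      "u \<in> universals Q" "mm a u a = Some v'" unfolding extension_axioms_def by blast
    then have "s u a \<in> set vs" using X_I[OF A(2,3)] vs(1) by auto
    then show "A \<in> set ?ls" using A def_s[OF A(4)] by force
  qed
  moreover have "dv (S * (2 * S * S + 6 * S + 5) + (S * S + 4 * S + 2)) extension_axioms {Fls}"
  proof (rule dv_refutation[OF Q'(4,3)])
    show "precedes Q' (s u a) u" if "i < length \<pi>" "u \<in> universals Q" "a \<in> dom (mm i u)" for i u a
      using Q'(6)[of "s u a"] X_I[OF that] vs(1) by (simp add: owner_s)
  qed (rule Q'(5))
  ultimately obtain ls' where ls': "efrege F Q \<phi> Q' (?ls @ ls')"
    "length ls' \<le> c * (S * (2 * S * S + 6 * S + 5) + (S * S + 4 * S + 2))"
    "\<forall>A\<in>set ls'. fsize A \<le> c * ?N" "Fls \<in> set (?ls @ ls')"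
    using Q'(1) unfolding dv_def derives_def by blast
  have line_size: "fsize A \<le> c * ?N" if A: "A \<in> set (?ls @ ls')" for A
  proof (cases "A \<in> set ls'")
    case False
    then obtain v where "A = Iff_f (Var v) (def v)" using A by auto
    then have "fsize A \<le> 10" using fsize_node_form_le by (simp add: def_def)
    also have "10 \<le> c * ?N" using mult_le_mono[OF assms(1), of 10 ?N] by simp
    finally show ?thesis .
  qed (use ls'(3) in blast)
  have "efrege_size (?ls @ ls') \<le> length (?ls @ ls') * (c * ?N)"
    unfolding efrege_size_def using sum_list_mono[of "?ls @ ls'" fsize "\<lambda>_. c * ?N"] line_size
    by (simp only: sum_list_triv of_nat_id)
  \<comment> \<open>At most \<open>S\<close> extension axioms, followed by \<open>c\<close> lines
    for each unit of cost.\<close>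
  also have "\<dots> \<le> (S + c * (S * (2 * S * S + 6 * S + 5) + (S * S + 4 * S + 2))) * (c * ?N)"
    using card_X ls'(2) vs(1) distinct_card[OF vs(2)] by (intro mult_le_mono1) simp
  finally have size: "efrege_size (?ls @ ls') \<le>
      (S + c * (S * (2 * S * S + 6 * S + 5) + (S * S + 4 * S + 2))) * (c * ?N)" .
  obtain \<rho> where "efrege_refutation F Q \<phi> \<rho>" "efrege_size \<rho> \<le> efrege_size (?ls @ ls')"
    using efrege_refutationI[OF ls'(1,4)] .
  then show ?thesis using order_trans[OF _ size] by blast
qed

theorem theorem3p3:
  fixes F :: "rule_schema set"
  assumes "frege_system F"
  shows "\<exists>P :: nat poly. \<forall>Q \<phi> \<pi>.
           closed_pcnf Q \<phi> \<longrightarrow> mres_refutation Q \<phi> \<pi> \<longrightarrow>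
           (\<exists>\<rho>. efrege_refutation F Q \<phi> \<rho> \<and> efrege_size \<rho> \<le> poly P (mres_size Q \<pi>))"
proof -
  \<comment> \<open>\<open>c\<close> is obtained from \<open>F\<close> alone, before prefix, matrix
    and proof are given, so the polynomial built from it is uniform.\<close>
  obtain c where c: "1 \<le> c" "\<forall>(Ps, A)\<in>set sim_rules. \<forall>Q \<phi> Q' N \<tau>. (\<forall>x. bounded_form Q' N (\<tau> x)) \<longrightarrow>
      derives F Q \<phi> Q' (c * N) c (fsubst \<tau> ` set Ps) {fsubst \<tau> A}"
    using frege_schemata_derives[OF assms finite_set sim_rules_sound] by blast
  define X :: "nat poly" where "X = [:0, 1:]"
  define P where "P = (X + [:c:] * (X * ([:2:] * X * X + [:6:] * X + [:5:]) +
      (X * X + [:4:] * X + [:2:]))) * ([:c:] * ([:5:] * X + [:10:]))"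
  show ?thesis
  proof (intro exI[of _ P] allI impI)
    fix Q \<phi> \<pi> assume "closed_pcnf Q \<phi>" "mres_refutation Q \<phi> \<pi>"
    then interpret mres_proof Q \<phi> \<pi> by unfold_locales
    have "poly P S = (S + c * (S * (2 * S * S + 6 * S + 5) + (S * S + 4 * S + 2))) * (c * (5 * S + 10))"
      by (simp add: P_def X_def algebra_simps)
    then show "\<exists>\<rho>. efrege_refutation F Q \<phi> \<rho> \<and> efrege_size \<rho> \<le> poly P (mres_size Q \<pi>)"
      using efrege_simulation[of c F] c by fastforce
  qed
qed

end
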